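(* For each fixed $\tau>0$, put $r=r(\tau)$, $C_0=C_0(\tau)$, and $q(s)=r^{2s}$. For every $N\ge2$ there are polynomials $p_{j,\tau}(s)$, $1\le j\le N$ (the coefficients of $\ell^{-j}$ in the expansion of the $s$-th power of $1+a_1(\tau)/\ell+\cdots+a_N(\tau)/\ell^N$), whose coefficients depend smoothly on $\tau$ and for which $p_{j,\tau}(0)=0$, such that for $\mathrm{Re}(s)>0$ $$Z_{\mathsf T}(s,\tau)=C_0^s\frac{1+q(s)}{(1-q(s))^2}+C_0^s\sum_{j=1}^Np_{j,\tau}(s)\Bigl(2\,\mathrm{Li}_{j-1}(q(s))+\mathrm{Li}_j(q(s))\Bigr)+\mathcal{R}_N(s,\tau),$$ where $\mathcal{R}_N$ is holomorphic in $\mathrm{Re}(s)>0$. On every compact set $K\Subset\{\mathrm{Re}(s)>0\}$ the defining remainder series $$\mathcal{R}_N(s,\tau)=(1-C_0^s)+\sum_{\ell=1}^\infty(2\ell+1)\Bigl(s_\ell(\tau)^s-C_0^s\,q(s)^\ell\bigl(1+\sum_{j=1}^Np_{j,\tau}(s)\ell^{-j}\bigr)\Bigr)$$ and all of its $s$-derivatives converge uniformly. The displayed finite sum (the right-hand side without $\mathcal{R}_N$) extends to the universal cover of $\mathbb{C}\setminus\mathcal{P}_\tau$, where $$\mathcal{P}_\tau:=\{s\in\mathbb{C}:q(s)=1\}=\left\{\frac{\pi ik}{\log r(\tau)}:k\in\mathbb{Z}\right\},$$ and has polylogarithmic singularities along $\mathcal{P}_\tau$. The first term on the right-hand side has a double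 pole at each point of $\mathcal{P}_\tau$, while the remaining displayed terms have at most simple poles together with the logarithmic terms prescribed by Jonquière's expansion of the polylogarithm. At $s=0$ the polar part of the first term is given by $$C_0^s\frac{1+q(s)}{(1-q(s))^2}=\frac{1}{2(\log r(\tau))^2}\,\frac1{s^2}+\frac{\log C_0(\tau)-\log r(\tau)}{2(\log r(\tau))^2}\,\frac1s+O(1).$$ Both of these coefficients vary with $\tau$.
   Context: For $\ell\in\mathbb{N}_0$ let $\mathrm{Sym}^{2\ell}\mathbb{C}^2$ be the space of homogeneous polynomials of degree $2\ell$ in $(z_0,z_1)$ with the Hermitian inner product for which the monomials are orthogonal and $\|z_0^{2\ell-k}z_1^k\|^2=\binom{2\ell}{k}^{-1}$. For $\tau>0$ put $u_\ell=z_0^{2\ell}$, $w_\ell(\tau)=(z_0^2+z_1^2+2\coth\tau\,z_0z_1)^\ell$, $\widehat v=v/\|v\|$, and $s_\ell(\tau)=|\langle\widehat w_\ell(\tau),\widehat u_\ell\rangle|^2$. For $\mathrm{Re}(s)>0$, $$Z_{\mathsf T}(s,\tau)=\sum_{\ell=0}^\infty(2\ell+1)\,s_\ell(\tau)^s,\qquad s_\ell(\tau)^s=\exp(s\log s_\ell(\tau))\ \text{(real logarithm)},$$ an absolutely convergent series. Put $$r(\tau)=\frac{1-e^{-2\tau}}2,\qquad C_0(\tau)=\sqrt{2\sinh(2\tau)}\,e^{-\tau}.$$ The smooth functions $a_j(\tau)$, $j\ge1$, are the coefficients in the complete asymptotic expansion, as $\ell\to\infty$ for fixed $\tau$, $$s_\ell(\tau)=C_0(\tau)r(\tau)^{2\ell}\Bigl(1+\frac{a_1(\tau)}\ell+\cdots+\frac{a_N(\tau)}{\ell^N}+O_{N,\tau}(\ell^{-N-1})\Bigr).$$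 $\mathrm{Li}_m(q)=\sum_{\ell\ge1}\ell^{-m}q^\ell$ for $|q|<1$ (so $\mathrm{Li}_0(q)=q/(1-q)$), extended by analytic continuation. Jonquière's expansion is, for $m\in\mathbb{N}$, $m\ge1$, and $\mu$ in a slit neighborhood $|\mu|<\epsilon$, $\mu\notin[0,\infty)$, $$\mathrm{Li}_m(e^\mu)=\frac{\mu^{m-1}}{(m-1)!}\bigl(H_{m-1}-\log(-\mu)\bigr)+\sum_{k\ge0,\,k\ne m-1}\frac{\zeta(m-k)}{k!}\mu^k,$$ with $H_{m-1}$ the harmonic number, $H_0=0$, and the principal branch of $\log(-\mu)$; the branch reached by continuation from $|q|<1$ (i.e. $\mathrm{Re}\,\mu<0$) is used. *)

theory Defs
  imports
    "HOL-Complex_Analysis.Complex_Analysis"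
    "HOL-Computational_Algebra.Formal_Power_Series"
    "HOL-Library.Landau_Symbols"
    "HOL-Library.Poly_Mapping"
    "HOL-Library.Product_Plus"
begin

section \<open>The overlaps $s_\ell(\tau)$\<close>

text \<open>
  \<^typ>\<open>(nat \<times> nat) \<Rightarrow>\<^sub>0 complex\<close>, with the convolution product of \<^theory>\<open>HOL-Library.Poly_Mapping\<close>,
  is the polynomial ring $\mathbb{C}[z_0,z_1]$: the key \<open>(i, k)\<close> is the monomial $z_0^i z_1^k$.
\<close>

type_synonym bipoly = "(nat \<times> nat) \<Rightarrow>\<^sub>0 complex"

definition z0 :: bipoly where "z0 = Poly_Mapping.single (1, 0) 1"

definition z1 :: bipoly where "z1 = Poly_Mapping.single (0, 1) 1"

definition cst :: "complex \<Rightarrow> bipoly" where "cst c = Poly_Mapping.single 0 c"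

text \<open>
  The Hermitian form on $\mathrm{Sym}^n\mathbb{C}^2$, the polynomials homogeneous of degree \<open>n\<close>, for which the monomials are orthogonal and
  $\|z_0^{n-k}z_1^k\|^2 = \binom nk^{-1}$.
\<close>

definition sym_inner :: "nat \<Rightarrow> bipoly \<Rightarrow> bipoly \<Rightarrow> complex" where
  "sym_inner n f g =
     (\<Sum>k\<le>n. Poly_Mapping.lookup f (n - k, k) * cnj (Poly_Mapping.lookup g (n - k, k))
        / of_nat (n choose k))"

definition sym_norm :: "nat \<Rightarrow> bipoly \<Rightarrow> real" where
  "sym_norm n f = sqrt (Re (sym_inner n f f))"

definition sym_hat :: "nat \<Rightarrow> bipoly \<Rightarrow> bipoly" where
  "sym_hat n f = cst (of_real (1 / sym_norm n f)) * f"

definition u_poly :: "nat \<Rightarrow> bipoly" where "u_poly l = z0 ^ (2 * l)"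

definition w_poly :: "nat \<Rightarrow> real \<Rightarrow> bipoly" where
  "w_poly l \<tau> = (z0 ^ 2 + z1 ^ 2 + cst (of_real (2 * (cosh \<tau> / sinh \<tau>))) * z0 * z1) ^ l"

definition sl :: "nat \<Rightarrow> real \<Rightarrow> real" where
  "sl l \<tau> = (cmod (sym_inner (2 * l) (sym_hat (2 * l) (w_poly l \<tau>)) (sym_hat (2 * l) (u_poly l)))) ^ 2"

lemma sym_inner_monom:
  assumes "i \<le> n" "k \<le> n"
  shows "sym_inner n (z0 ^ (n - i) * z1 ^ i) (z0 ^ (n - k) * z1 ^ k) =
           (if i = k then 1 / of_nat (n choose k) else 0)"
proof -
  have z0p: "z0 ^ m = Poly_Mapping.single (m, 0) 1" for m
    by (induction m) (simp_all add: z0_def Poly_Mapping.mult_single zero_prod_def[symmetric])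
  have z1p: "z1 ^ m = Poly_Mapping.single (0, m) 1" for m
    by (induction m) (simp_all add: z1_def Poly_Mapping.mult_single zero_prod_def[symmetric])
  have m: "z0 ^ a * z1 ^ b = Poly_Mapping.single (a, b) 1" for a b
    by (simp add: z0p z1p Poly_Mapping.mult_single)
  have "sym_inner n (z0 ^ (n - i) * z1 ^ i) (z0 ^ (n - k) * z1 ^ k) =
          (\<Sum>j\<le>n. if j = k then (if i = k then 1 / of_nat (n choose k) else 0) else 0)"
    unfolding sym_inner_def m by (intro sum.cong) (auto simp: lookup_single when_def)
  then show ?thesis using assms by simp
qed

section \<open>The zeta function and its expansion\<close>

definition sl_pow :: "nat \<Rightarrow> real \<Rightarrow> complex \<Rightarrow> complex" where
  "sl_pow l \<tau> s = exp (s * of_real (ln (sl l \<tau>)))"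

definition Z_T :: "complex \<Rightarrow> real \<Rightarrow> complex" where
  "Z_T s \<tau> = suminf (\<lambda>l. of_nat (2 * l + 1) * sl_pow l \<tau> s)"

definition rr :: "real \<Rightarrow> real" where "rr \<tau> = (1 - exp (- 2 * \<tau>)) / 2"

definition C0 :: "real \<Rightarrow> real" where "C0 \<tau> = sqrt (2 * sinh (2 * \<tau>)) * exp (- \<tau>)"

definition C0_pow :: "real \<Rightarrow> complex \<Rightarrow> complex" where
  "C0_pow \<tau> s = of_real (C0 \<tau>) powr s"

definition qq :: "real \<Rightarrow> complex \<Rightarrow> complex" where
  "qq \<tau> s = of_real (rr \<tau>) powr (2 * s)"

definition PP :: "real \<Rightarrow> complex set" where "PP \<tau> = {s. qq \<tau> s = 1}"

text \<open>$C^\infty$ on an open set of reals, with values in any normed space.\<close>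

definition smooth_on_reals :: "real set \<Rightarrow> (real \<Rightarrow> 'a::real_normed_vector) \<Rightarrow> bool" where
  "smooth_on_reals S f \<longleftrightarrow>
     (\<exists>D. (\<forall>x\<in>S. D 0 x = f x) \<and>
          (\<forall>k::nat. \<forall>x\<in>S. (D k has_vector_derivative D (Suc k) x) (at x)))"

text \<open>
  \<open>a j \<tau>\<close> (for \<open>j \<ge> 1\<close>) are the coefficients of the complete asymptotic expansion of
  \<open>sl l \<tau>\<close> as \<open>l \<rightarrow> \<infinity>\<close>, for each fixed \<open>\<tau>\<close>; the value \<open>a 0\<close> is irrelevant.
\<close>

definition expansion_coeffs :: "(nat \<Rightarrow> real \<Rightarrow> real) \<Rightarrow> bool" where
  "expansion_coeffs a \<longleftrightarrow>
     (\<forall>j\<ge>1. smooth_on_reals {0<..} (a j)) \<and>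
     (\<forall>\<tau>>0. \<forall>N. \<exists>E. E \<in> O(\<lambda>l. 1 / real l ^ (N + 1)) \<and>
        (\<forall>l\<ge>1. sl l \<tau> = C0 \<tau> * rr \<tau> ^ (2 * l) *
                  (1 + (\<Sum>j=1..N. a j \<tau> / real l ^ j) + E l)))"

text \<open>
  The coefficient of $x^j$ in $(1 + a_1(\tau) x + \dots + a_N(\tau) x^N)^s$, where the formal
  $s$-th power is the binomial series of $(1 + X)^s$ with $\sum_i a_i(\tau)x^i$ substituted
  for $X$.
\<close>

definition power_coeff ::
  "(nat \<Rightarrow> real \<Rightarrow> real) \<Rightarrow> nat \<Rightarrow> real \<Rightarrow> complex \<Rightarrow> nat \<Rightarrow> complex" where
  "power_coeff a N \<tau> s j =
     fps_nth (fps_binomial s oo (\<Sum>i=1..N. fps_const (of_real (a i \<tau>)) * fps_X ^ i)) j"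

text \<open>The series for $\mathrm{Li}_m(x)$ in the unit disc.\<close>

definition polylog :: "nat \<Rightarrow> complex \<Rightarrow> complex" where
  "polylog m x = suminf (\<lambda>l. x ^ Suc l / of_nat (Suc l) ^ m)"

definition first_term :: "real \<Rightarrow> complex \<Rightarrow> complex" where
  "first_term \<tau> s = C0_pow \<tau> s * ((1 + qq \<tau> s) / (1 - qq \<tau> s) ^ 2)"

definition polylog_term :: "(nat \<Rightarrow> real \<Rightarrow> complex poly) \<Rightarrow> nat \<Rightarrow> real \<Rightarrow> complex \<Rightarrow> complex" where
  "polylog_term p j \<tau> s =
     C0_pow \<tau> s * (poly (p j \<tau>) s * (2 * polylog (j - 1) (qq \<tau> s) + polylog j (qq \<tau> s)))"

definition displayed_sum ::
  "(nat \<Rightarrow> real \<Rightarrow> complex poly) \<Rightarrow> nat \<Rightarrow> real \<Rightarrow> complex \<Rightarrow> complex" where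
  "displayed_sum p N \<tau> s = first_term \<tau> s + (\<Sum>j=1..N. polylog_term p j \<tau> s)"

definition remainder_term ::
  "(nat \<Rightarrow> real \<Rightarrow> complex poly) \<Rightarrow> nat \<Rightarrow> real \<Rightarrow> nat \<Rightarrow> complex \<Rightarrow> complex" where
  "remainder_term p N \<tau> l s =
     of_nat (2 * l + 1) *
       (sl_pow l \<tau> s -
        C0_pow \<tau> s * qq \<tau> s ^ l * (1 + (\<Sum>j=1..N. poly (p j \<tau>) s / of_nat l ^ j)))"

definition remainder ::
  "(nat \<Rightarrow> real \<Rightarrow> complex poly) \<Rightarrow> nat \<Rightarrow> real \<Rightarrow> complex \<Rightarrow> complex" where
  "remainder p N \<tau> s = (1 - C0_pow \<tau> s) + suminf (\<lambda>l. remainder_term p N \<tau> (Suc l) s)"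

section \<open>Functions on the universal cover of a plane domain\<close>

text \<open>
  The universal cover of an open connected \<open>U \<subseteq> \<complex>\<close> with base point \<open>b \<in> U\<close> is the set of
  classes of paths in \<open>U\<close> from \<open>b\<close>, modulo homotopy with fixed end points; the class of \<open>g\<close>
  lies over \<^term>\<open>pathfinish g\<close>.  A disc \<open>D \<subseteq> U\<close> centred at \<^term>\<open>pathfinish g\<close> lifts
  to the chart \<open>x \<mapsto> [g +++ linepath (pathfinish g) x]\<close> around \<open>[g]\<close>.
\<close>

definition paths_from :: "complex set \<Rightarrow> complex \<Rightarrow> (real \<Rightarrow> complex) set" where
  "paths_from U b = {g. path g \<and> path_image g \<subseteq> U \<and> pathstart g = b}"

definition path_class :: "complex set \<Rightarrow> (real \<Rightarrow> complex) \<Rightarrow> (real \<Rightarrow> complex) set" where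
  "path_class U g = {h. homotopic_paths U g h}"

definition holomorphic_on_cover ::
  "complex set \<Rightarrow> complex \<Rightarrow> ((real \<Rightarrow> complex) set \<Rightarrow> complex) \<Rightarrow> bool" where
  "holomorphic_on_cover U b F \<longleftrightarrow>
     (\<forall>g \<in> paths_from U b. \<forall>e>0. ball (pathfinish g) e \<subseteq> U \<longrightarrow>
        (\<lambda>x. F (path_class U (g +++ linepath (pathfinish g) x)))
          holomorphic_on ball (pathfinish g) e)"

text \<open>
  \<open>F\<close> on the universal cover extends \<open>f\<close>, given on a convex \<open>H \<subseteq> U\<close> containing the base point:
  \<open>H\<close> is identified with its lift through the class of the constant path.
\<close>

definition cover_extends ::
  "complex set \<Rightarrow> complex \<Rightarrow> complex set \<Rightarrow> (complex \<Rightarrow> complex) \<Rightarrow>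
     ((real \<Rightarrow> complex) set \<Rightarrow> complex) \<Rightarrow> bool" where
  "cover_extends U b H f F \<longleftrightarrow>
     holomorphic_on_cover U b F \<and> (\<forall>s\<in>H. F (path_class U (linepath b s)) = f s)"

text \<open>
  Near an isolated puncture \<open>p\<close>, on every sheet (fixed by a path \<open>g\<close> ending in the slit disc and
  continued along paths \<open>d\<close> inside the slit disc), \<open>F\<close> is a polar part of order at most \<open>n\<close>,
  plus a function holomorphic at \<open>p\<close>, plus \<open>\<Lambda>\<close>.
\<close>

definition slit_ball :: "complex \<Rightarrow> real \<Rightarrow> complex set" where
  "slit_ball p e = {x \<in> ball p e. x - p \<notin> \<real>\<^sub>\<le>\<^sub>0}"

definition cover_singularity ::
  "complex set \<Rightarrow> complex \<Rightarrow> ((real \<Rightarrow> complex) set \<Rightarrow> complex) \<Rightarrow>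
     complex \<Rightarrow> nat \<Rightarrow> (complex \<Rightarrow> complex) \<Rightarrow> bool" where
  "cover_singularity U b F p n \<Lambda> \<longleftrightarrow>
     (\<exists>e>0. ball p e - {p} \<subseteq> U \<and>
        (\<forall>g \<in> paths_from U b. pathfinish g \<in> slit_ball p e \<longrightarrow>
           (\<exists>c h. h holomorphic_on ball p e \<and>
              (\<forall>d. path d \<and> path_image d \<subseteq> slit_ball p e \<and> pathstart d = pathfinish g \<longrightarrow>
                 F (path_class U (g +++ d)) =
                   (\<Sum>k=1..n. c k / (pathfinish d - p) ^ k) + h (pathfinish d) + \<Lambda> (pathfinish d)))))"

text \<open>
  The logarithmic term of Jonquiere's expansion of $\mathrm{Li}_m(e^\mu)$ at $\mu = 0$
  (there is none for $m = 0$), and the resulting one of \<^const>\<open>polylog_term\<close> at a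
  puncture \<open>p\<close>, where $\mu = 2(s-p)\log r(\tau)$, so that $e^\mu = q(s)$.  As $\log r(\tau) < 0$,
  the slit $\mu \in [0,\infty)$ is \<open>s - p \<in> \<real>\<^sub>\<le>\<^sub>0\<close>.
\<close>

definition jonquiere_log :: "nat \<Rightarrow> complex \<Rightarrow> complex" where
  "jonquiere_log m \<mu> =
     (if m = 0 then 0 else - (\<mu> ^ (m - 1) / fact (m - 1)) * Ln (- \<mu>))"

definition log_part ::
  "(nat \<Rightarrow> real \<Rightarrow> complex poly) \<Rightarrow> nat \<Rightarrow> real \<Rightarrow> complex \<Rightarrow> complex \<Rightarrow> complex" where
  "log_part p j \<tau> z s =
     (let \<mu> = 2 * (s - z) * of_real (ln (rr \<tau>))
      in C0_pow \<tau> s * (poly (p j \<tau>) s * (2 * jonquiere_log (j - 1) \<mu> + jonquiere_log j \<mu>)))"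

end

theory Submission
  imports Defs "HOL-Real_Asymp.Real_Asymp"
begin

text \<open>
  For $\mathrm{Re}(s)>0$ every series is dominated by a geometric one, locally uniformly in \<open>s\<close>, so
  the identity for $Z_{\mathsf T}$ is a rearrangement and the derivatives of the remainder series
  converge by Cauchy's inequality.

  For the continuation put $c = 2\log r$. Repeated integration gives
  $$\mathrm{Li}_m(e^{cs}) = \text{polynomial in } s +
    c^m\int_1^s \frac{(s-t)^{m-1}}{(m-1)!}\,\mathrm{Li}_0(e^{ct})\,dt,$$
  and $\mathrm{Li}_0(e^{ct}) = e^{ct}/(1-e^{ct})$ is single-valued on the punctured plane. Expanding the
  kernel, the continuation to the universal cover is a combination, with entire coefficients, of
  integrals of $t^k\,\mathrm{Li}_0(e^{ct})$ along paths, which depend only on the homotopy class. On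
  every sheet such an integral is $-c^{-1}z^k\log(s-z)$ plus a holomorphic function near a puncture
  \<open>z\<close>; resumming the kernel yields Jonquiere's logarithm with the same coefficient on each sheet.
\<close>

subsection \<open>Locally uniform limits of holomorphic functions\<close>

text \<open>Neither the zeta values in Jonquiere's expansion nor any monodromy is computed.
  Integration constants gather in entire functions of \<open>s\<close>, and what an integral has
  picked up before its path enters a slit disc is a constant on that sheet. Times entire kernel
  coefficients, both end up in the holomorphic part \<open>h\<close>, which
  \<open>cover_singularity\<close> leaves free on every sheet. The kernel must be split into powers
  of \<open>t\<close> because only a fixed integrand on the punctured plane has an integral attached
  to a homotopy class, while \<open>(s - t) ^ n\<close> moves with the end point \<open>s\<close>.
  All local expansions live on discs of radius \<open>2 * pi / |c|\<close>, the distance between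
  neighbouring punctures, so that the terms of the displayed sum can be added.\<close>

lemma
  assumes S: "open S" and hol: "\<And>n. f n holomorphic_on S"
    and lim: "\<And>K. compact K \<Longrightarrow> K \<subseteq> S \<Longrightarrow> uniform_limit K f g sequentially"
  shows holomorphic_compact_limit: "g holomorphic_on S"
    and uniform_limit_higher_deriv: "compact K \<Longrightarrow> K \<subseteq> S \<Longrightarrow>
      uniform_limit K (\<lambda>n. (deriv ^^ m) (f n)) ((deriv ^^ m) g) sequentially"
proof -
  show g: "g holomorphic_on S"
  proof (rule holomorphic_uniform_sequence[OF S hol])
    fix x assume "x \<in> S"
    then obtain d where "d > 0" "cball x d \<subseteq> S" using open_contains_cball_eq[OF S] by blast
    then show "\<exists>d>0. cball x d \<subseteq> S \<and> uniform_limit (cball x d) f g sequentially"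
      using lim[OF compact_cball] by blast
  qed
  assume K: "compact K" "K \<subseteq> S"
  \<comment> \<open>One radius \<open>d\<close> serves all of \<open>K\<close>, so Cauchy's
    inequality bounds the \<open>m\<close>-th derivative of \<open>f n - g\<close> on
    \<open>K\<close> by its supremum on the closed \<open>d\<close>-neighbourhood \<open>L\<close>.
    As a sum of two compact sets, \<open>L\<close> is compact, and the hypothesis on uniform limits
    applies to it.\<close>
  obtain d where d: "d > 0" "(\<Union>x\<in>K. cball x d) \<subseteq> S"
    using compact_subset_open_imp_cball_epsilon_subset[OF K(1) S K(2)] by blast
  define L where "L = (\<Union>x\<in>K. cball x d)"
  have "L = {x + y | x y. x \<in> K \<and> y \<in> cball 0 d}"
  proof (intro set_eqI iffI)
    fix w assume "w \<in> L"
    then obtain x where "x \<in> K" "w \<in> cball x d" by (auto simp: L_def)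
    then have "w = x + (w - x) \<and> x \<in> K \<and> w - x \<in> cball 0 d"
      by (simp add: dist_norm norm_minus_commute)
    then show "w \<in> {x + y | x y. x \<in> K \<and> y \<in> cball 0 d}" by blast
  next
    fix w assume "w \<in> {x + y | x y. x \<in> K \<and> y \<in> cball 0 d}"
    then obtain x y where "w = x + y" "x \<in> K" "y \<in> cball 0 d" by blast
    then have "x \<in> K" "w \<in> cball x d" by (simp_all add: dist_norm)
    then show "w \<in> L" unfolding L_def by blast
  qed
  then have L: "compact L" using compact_sums[OF K(1) compact_cball[of 0 d]] by simp
  have LS: "L \<subseteq> S" using d by (simp add: L_def)
  show "uniform_limit K (\<lambda>n. (deriv ^^ m) (f n)) ((deriv ^^ m) g) sequentially"
  proof (rule uniform_limitI)
    fix e :: real assume e: "e > 0"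
    \<comment> \<open>Chosen so that Cauchy's bound \<open>fact m * e' / d ^ m\<close> equals
      \<open>e / 2\<close>.\<close>
    define e' where "e' = e * d ^ m / (2 * fact m)"
    have "e' > 0" using e d by (simp add: e'_def)
    then have "\<forall>\<^sub>F n in sequentially. \<forall>x\<in>L. dist (f n x) (g x) < e'"
      using lim[OF L LS] by (auto simp: uniform_limit_iff)
    then show "\<forall>\<^sub>F n in sequentially. \<forall>x\<in>K. dist ((deriv ^^ m) (f n) x) ((deriv ^^ m) g x) < e"
    proof eventually_elim
      case (elim n)
      show ?case
      proof
        fix x assume x: "x \<in> K"
        have sub: "cball x d \<subseteq> L" using x by (auto simp: L_def)
        have hd: "(\<lambda>w. f n w - g w) holomorphic_on S" by (intro holomorphic_on_diff hol g)
        have "norm ((deriv ^^ m) (\<lambda>w. f n w - g w) x) \<le> fact m * e' / d ^ m"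
        proof (rule Cauchy_inequality)
          show "(\<lambda>w. f n w - g w) holomorphic_on ball x d"
            by (rule holomorphic_on_subset[OF hd]) (use sub LS ball_subset_cball in blast)
          show "continuous_on (cball x d) (\<lambda>w. f n w - g w)"
            by (rule holomorphic_on_imp_continuous_on, rule holomorphic_on_subset[OF hd])
              (use sub LS in blast)
          fix w assume "norm (x - w) = d"
          then have "w \<in> cball x d" by (simp add: dist_norm)
          then have "w \<in> L" using sub by blast
          then show "norm (f n w - g w) \<le> e'" using elim by (simp add: dist_norm less_imp_le)
        qed (use d in auto)
        also have "\<dots> = e / 2" using d by (simp add: e'_def)
        also have "\<dots> < e" using e by simp
        finally show "dist ((deriv ^^ m) (f n) x) ((deriv ^^ m) g x) < e"
          using higher_deriv_diff[OF hol g S, of x m n] x K(2) by (simp add: dist_norm subset_iff)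
      qed
    qed
  qed
qed

subsection \<open>Smoothness and the coefficient polynomials\<close>

text \<open>\<open>smooth_on_reals\<close> demands the whole sequence of derivatives at once. A
  class closed under differentiation supplies it by iterating one choice of derivative, which spares
  formulas for \<open>k\<close>-fold derivatives.\<close>

lemma smooth_on_reals_coinduct:
  assumes "X f"
    and step: "\<And>f. X f \<Longrightarrow> \<exists>f'. X f' \<and> (\<forall>x\<in>S. (f has_vector_derivative f' x) (at x))"
  shows "smooth_on_reals S f"
proof -
  obtain d where d: "\<And>f. X f \<Longrightarrow> X (d f) \<and> (\<forall>x\<in>S. (f has_vector_derivative d f x) (at x))"
    using step by metis
  have "X ((d ^^ k) f)" for k by (induction k) (use assms(1) d in auto)
  then show ?thesis
    unfolding smooth_on_reals_def by (intro exI[of _ "\<lambda>k. (d ^^ k) f"]) (use d in auto)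
qed

lemma smooth_on_reals_derivative:
  assumes "smooth_on_reals S f" "open S"
  obtains f' where "smooth_on_reals S f'" "\<And>x. x \<in> S \<Longrightarrow> (f has_vector_derivative f' x) (at x)"
proof -
  obtain D where D: "\<And>x. x \<in> S \<Longrightarrow> D 0 x = f x"
    "\<And>k x. x \<in> S \<Longrightarrow> (D k has_vector_derivative D (Suc k) x) (at x)"
    using assms unfolding smooth_on_reals_def by blast
  have "smooth_on_reals S (D (Suc 0))"
    unfolding smooth_on_reals_def by (intro exI[of _ "\<lambda>k. D (Suc k)"]) (use D in auto)
  moreover have "(f has_vector_derivative D (Suc 0) x) (at x)" if "x \<in> S" for x
    using has_vector_derivative_transform_within_open[OF D(2)[OF that] assms(2) that] D(1) by auto
  ultimately show ?thesis using that by blast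
qed

text \<open>The derivative of a product is a sum of products, so sums and products have to be closed
  up together before coinduction can be applied. This class is the resulting invariant.\<close>

inductive smooth_alg :: "real set \<Rightarrow> (real \<Rightarrow> 'a::real_normed_algebra) \<Rightarrow> bool" for S where
  smooth: "smooth_on_reals S f \<Longrightarrow> smooth_alg S f"
| const: "smooth_alg S (\<lambda>_. c)"
| add: "smooth_alg S f \<Longrightarrow> smooth_alg S g \<Longrightarrow> smooth_alg S (\<lambda>x. f x + g x)"
| mult: "smooth_alg S f \<Longrightarrow> smooth_alg S g \<Longrightarrow> smooth_alg S (\<lambda>x. f x * g x)"

lemma smooth_alg_smooth:
  assumes "smooth_alg S f" "open S"
  shows "smooth_on_reals S f"
proof (rule smooth_on_reals_coinduct[of "smooth_alg S"])
  fix f assume "smooth_alg S f"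
  then show "\<exists>f'. smooth_alg S f' \<and> (\<forall>x\<in>S. (f has_vector_derivative f' x) (at x))"
  proof induction
    case (smooth f)
    show ?case by (rule smooth_on_reals_derivative[OF smooth assms(2)]) (blast intro: smooth_alg.smooth)
  next
    case (const c)
    then show ?case by (intro exI[of _ "\<lambda>_. 0"]) (auto intro: smooth_alg.const)
  next
    case (add f g)
    then obtain f' g' where "smooth_alg S f'" "smooth_alg S g'"
      "\<And>x. x \<in> S \<Longrightarrow> (f has_vector_derivative f' x) (at x)"
      "\<And>x. x \<in> S \<Longrightarrow> (g has_vector_derivative g' x) (at x)" by blast
    then show ?case
      by (intro exI[of _ "\<lambda>x. f' x + g' x"]) (auto intro!: smooth_alg.add has_vector_derivative_add)
  next
    case (mult f g)
    then obtain f' g' where "smooth_alg S f'" "smooth_alg S g'"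
      "\<And>x. x \<in> S \<Longrightarrow> (f has_vector_derivative f' x) (at x)"
      "\<And>x. x \<in> S \<Longrightarrow> (g has_vector_derivative g' x) (at x)" by blast
    with mult.hyps show ?case
      by (intro exI[of _ "\<lambda>x. f x * g' x + f' x * g x"])
        (auto intro!: smooth_alg.add smooth_alg.mult has_vector_derivative_mult)
  qed
qed fact

lemma smooth_alg_sum:
  fixes f :: "'i \<Rightarrow> real \<Rightarrow> 'a::real_normed_algebra"
  assumes "\<And>i. i \<in> I \<Longrightarrow> smooth_alg S (f i)"
  shows "smooth_alg S (\<lambda>x. \<Sum>i\<in>I. f i x)"
  using assms
  by (induction I rule: infinite_finite_induct) (auto intro: smooth_alg.const smooth_alg.add)

lemma smooth_on_reals_of_real:
  assumes "smooth_on_reals S f" "open S"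
  shows "smooth_on_reals S (\<lambda>x. of_real (f x) :: 'a::real_normed_field)"
proof (rule smooth_on_reals_coinduct[of "\<lambda>h. \<exists>f. smooth_on_reals S f \<and> h = (\<lambda>x. of_real (f x))"])
  fix h :: "real \<Rightarrow> 'a" assume "\<exists>f. smooth_on_reals S f \<and> h = (\<lambda>x. of_real (f x))"
  then obtain f where f: "smooth_on_reals S f" and h: "h = (\<lambda>x. of_real (f x))" by blast
  obtain f' where "smooth_on_reals S f'" "\<And>x. x \<in> S \<Longrightarrow> (f has_vector_derivative f' x) (at x)"
    by (rule smooth_on_reals_derivative[OF f assms(2)]) blast
  then show "\<exists>h'. (\<exists>f. smooth_on_reals S f \<and> h' = (\<lambda>x. of_real (f x))) \<and>
      (\<forall>x\<in>S. (h has_vector_derivative h' x) (at x))"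
    unfolding h by (intro exI[of _ "\<lambda>x. of_real (f' x)"]) (auto intro!: has_vector_derivative_of_real
        simp: has_real_derivative_iff_has_vector_derivative)
qed (use assms in blast)

lemma smooth_alg_fps_power_nth:
  fixes B :: "real \<Rightarrow> complex fps"
  assumes "\<And>i. smooth_alg S (\<lambda>x. fps_nth (B x) i)"
  shows "smooth_alg S (\<lambda>x. fps_nth (B x ^ k) i)"
  by (induction k arbitrary: i)
    (auto simp: fps_mult_nth intro!: smooth_alg_sum smooth_alg.mult assms smooth_alg.const)

section \<open>The coefficients of the formal \<open>s\<close>-th power as polynomials in
  \<open>s\<close>\<close>

definition gbinomial_poly :: "nat \<Rightarrow> complex poly" where
  "gbinomial_poly k = smult (1 / fact k) (\<Prod>i<k. [:- of_nat i, 1:])"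

lemma poly_gbinomial_poly: "poly (gbinomial_poly k) s = s gchoose k"
  by (simp add: gbinomial_poly_def gbinomial_prod_rev poly_prod atLeast0LessThan)

text \<open>The substituted series has no constant term, so its powers beyond the
  \<open>j\<close>-th do not reach the coefficient of \<open>x^j\<close>. The exponent
  \<open>s\<close> enters only through the finitely many binomials \<open>s gchoose k\<close>,
  whence a polynomial in \<open>s\<close>.\<close>

definition power_poly :: "(nat \<Rightarrow> real \<Rightarrow> real) \<Rightarrow> nat \<Rightarrow> nat \<Rightarrow> real \<Rightarrow> complex poly" where
  "power_poly a N j \<tau> = (\<Sum>k\<le>j.
     smult (fps_nth ((\<Sum>i=1..N. fps_const (of_real (a i \<tau>)) * fps_X ^ i) ^ k) j) (gbinomial_poly k))"

lemma poly_power_poly: "poly (power_poly a N j \<tau>) s = power_coeff a N \<tau> s j"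
  by (simp add: power_poly_def power_coeff_def fps_compose_nth poly_sum poly_gbinomial_poly
      atMost_atLeast0 mult.commute)

text \<open>\<open>0 gchoose k\<close> vanishes for \<open>k > 0\<close>, and for
  \<open>k = 0\<close> the power of the inner series is 1, which has no coefficient at
  \<open>j >= 1\<close>.\<close>

lemma poly_power_poly_0: "j \<ge> 1 \<Longrightarrow> poly (power_poly a N j \<tau>) 0 = 0"
  unfolding power_poly_def poly_sum poly_smult poly_gbinomial_poly
  by (intro sum.neutral ballI) (auto simp: gbinomial_0_left split: if_splits)

lemma smooth_coeff_power_poly:
  assumes "\<And>j. j \<ge> 1 \<Longrightarrow> smooth_on_reals {0<..} (a j)"
  shows "smooth_on_reals {0<..} (\<lambda>\<tau>. coeff (power_poly a N j \<tau>) k)"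
proof -
  have "smooth_alg {0<..} (\<lambda>\<tau>. fps_nth (\<Sum>i=1..N. fps_const (of_real (a i \<tau>)) * fps_X ^ i) m :: complex)"
    for m
    unfolding fps_sum_nth fps_mult_left_const_nth
    by (intro smooth_alg_sum smooth_alg.mult smooth_alg.smooth smooth_alg.const
        smooth_on_reals_of_real assms) auto
  then show ?thesis unfolding power_poly_def coeff_sum coeff_smult
    by (intro smooth_alg_smooth smooth_alg_sum smooth_alg.mult smooth_alg.const smooth_alg_fps_power_nth)
      auto
qed

subsection \<open>Path integrals on the universal cover\<close>

text \<open>The projection of the cover to the plane. Homotopies fix end points, so the chosen
  representative does not matter.\<close>

definition lift_end :: "(real \<Rightarrow> complex) set \<Rightarrow> complex" where
  "lift_end C = pathfinish (SOME h. h \<in> C)"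

text \<open>A class consists of merely continuous paths, while contour integrals are taken along
  piecewise smooth ones; hence the choice is among valid paths. For \<open>f\<close> holomorphic on
  an open \<open>U\<close>, \<open>homotopic_valid_path\<close> makes it possible and Cauchy's
  theorem makes it immaterial.\<close>

definition lift_int :: "(complex \<Rightarrow> complex) \<Rightarrow> (real \<Rightarrow> complex) set \<Rightarrow> complex" where
  "lift_int f C = contour_integral (SOME h. h \<in> C \<and> valid_path h) f"

lemma lift_end_path_class [simp]:
  assumes "path g" "path_image g \<subseteq> U"
  shows "lift_end (path_class U g) = pathfinish g"
proof -
  have "g \<in> path_class U g" using assms by (simp add: path_class_def)
  then have "(SOME h. h \<in> path_class U g) \<in> path_class U g" by (rule someI[of "\<lambda>h. h \<in> path_class U g"])
  then have "homotopic_paths U g (SOME h. h \<in> path_class U g)"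
    by (simp add: path_class_def)
  then show ?thesis unfolding lift_end_def by (simp add: homotopic_paths_imp_pathfinish)
qed

text \<open>In an open set, uniformly close paths with common end points are homotopic, and
  polynomial paths approximate every path with its end points kept.\<close>

lemma homotopic_valid_path:
  fixes g :: "real \<Rightarrow> complex"
  assumes "path g" "path_image g \<subseteq> U" "open U"
  obtains h where "valid_path h" "homotopic_paths U g h"
proof -
  obtain e where e: "e > 0" and h: "\<And>h. path h \<Longrightarrow> pathstart h = pathstart g \<Longrightarrow>
      pathfinish h = pathfinish g \<Longrightarrow> (\<And>t. t \<in> {0..1} \<Longrightarrow> norm (h t - g t) < e) \<Longrightarrow>
      homotopic_paths U g h"
    using homotopic_nearby_paths[OF assms(1,3,2)] by blast
  obtain p where "polynomial_function p" "pathstart p = pathstart g"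
    "pathfinish p = pathfinish g" "\<And>t. t \<in> {0..1} \<Longrightarrow> norm (p t - g t) < e"
    using path_approx_polynomial_function[OF assms(1) e] by blast
  then show ?thesis
    using that[of p] h[of p] valid_path_polynomial_function valid_path_imp_path by blast
qed

lemma lift_int_eq:
  assumes "open U" "f holomorphic_on U" "homotopic_paths U g h" "valid_path h"
  shows "lift_int f (path_class U g) = contour_integral h f"
proof -
  let ?k = "SOME k. k \<in> path_class U g \<and> valid_path k"
  have "?k \<in> path_class U g \<and> valid_path ?k"
    by (rule someI[of _ h]) (use assms in \<open>simp add: path_class_def\<close>)
  then have "homotopic_paths U ?k h" "valid_path ?k"
    using assms(3) by (auto simp: path_class_def intro: homotopic_paths_sym homotopic_paths_trans)
  then show ?thesis
    unfolding lift_int_def using Cauchy_theorem_homotopic_paths assms by blast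
qed

text \<open>Continuation along a last piece \<open>d\<close> reduces to evaluating a local
  primitive. \<open>V\<close> will be a disc when holomorphy on the cover is checked, and a slit
  disc, with a logarithm in \<open>P\<close>, at a puncture.\<close>

lemma lift_int_join:
  assumes U: "open U" "f holomorphic_on U" and g: "path g" "path_image g \<subseteq> U"
    and V: "open V" "V \<subseteq> U" "\<And>x. x \<in> V \<Longrightarrow> (P has_field_derivative f x) (at x)"
    and d: "path d" "path_image d \<subseteq> V" "pathstart d = pathfinish g"
  shows "lift_int f (path_class U (g +++ d)) =
    lift_int f (path_class U g) + (P (pathfinish d) - P (pathstart d))"
proof -
  obtain g' where g': "valid_path g'" "homotopic_paths U g g'"
    using homotopic_valid_path[OF g U(1)] .
  \<comment> \<open>The regularisation of \<open>d\<close> happens inside \<open>V\<close>, not just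
    inside \<open>U\<close>, so that \<open>d'\<close> stays where \<open>P\<close> is a
    primitive.\<close>
  obtain d' where d': "valid_path d'" "homotopic_paths V d d'"
    using homotopic_valid_path[OF d(1,2) V(1)] .
  have "homotopic_paths U d d'" using d'(2) V(2) by (rule homotopic_paths_subset)
  then have hom: "homotopic_paths U (g +++ d) (g' +++ d')"
    using g'(2) d(3) by (intro homotopic_paths_join) auto
  have ends: "pathfinish g' = pathstart d'" "pathstart d' = pathstart d" "pathfinish d' = pathfinish d"
    using g'(2) d'(2) d(3) homotopic_paths_imp_pathstart homotopic_paths_imp_pathfinish by metis+
  have img: "path_image g' \<subseteq> U" "path_image d' \<subseteq> V"
    using g'(2) d'(2) homotopic_paths_imp_subset by blast+
  have int: "(f has_contour_integral (P (pathfinish d') - P (pathstart d'))) d'"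
    by (rule contour_integral_primitive[where S = V])
      (use V(3) d'(1) img in \<open>auto intro: has_field_derivative_at_within\<close>)
  have "lift_int f (path_class U (g +++ d)) = contour_integral (g' +++ d') f"
    by (rule lift_int_eq[OF U hom]) (use g' d' ends in \<open>simp add: valid_path_join\<close>)
  also have "\<dots> = contour_integral g' f + contour_integral d' f"
    using g' d' ends img U int
    by (intro contour_integral_join) (auto intro: contour_integrable_holomorphic_simple
        has_contour_integral_integrable)
  also have "contour_integral g' f = lift_int f (path_class U g)"
    using lift_int_eq[OF U g'(2,1)] by simp
  also have "contour_integral d' f = P (pathfinish d) - P (pathstart d)"
    using contour_integral_unique[OF int] ends by simp
  finally show ?thesis .
qed

lemma lift_int_primitive:
  assumes U: "open U" "f holomorphic_on U"
    and V: "open V" "V \<subseteq> U" "\<And>x. x \<in> V \<Longrightarrow> (P has_field_derivative f x) (at x)"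
    and d: "path d" "path_image d \<subseteq> V"
  shows "lift_int f (path_class U d) = P (pathfinish d) - P (pathstart d)"
proof -
  obtain d' where d': "valid_path d'" "homotopic_paths V d d'"
    using homotopic_valid_path[OF d V(1)] .
  have hom: "homotopic_paths U d d'" using d'(2) V(2) by (rule homotopic_paths_subset)
  have "(f has_contour_integral (P (pathfinish d') - P (pathstart d'))) d'"
    by (rule contour_integral_primitive[where S = V])
      (use V(3) d'(1) homotopic_paths_imp_subset[OF d'(2)] in
        \<open>auto intro: has_field_derivative_at_within\<close>)
  then show ?thesis
    using lift_int_eq[OF U hom d'(1)] contour_integral_unique
      homotopic_paths_imp_pathstart[OF hom] homotopic_paths_imp_pathfinish[OF hom] by metis
qed

lemma path_image_join_linepath_subset:
  assumes "path g" "path_image g \<subseteq> U" "ball (pathfinish g) e \<subseteq> U" "x \<in> ball (pathfinish g) e"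
  shows "path (g +++ linepath (pathfinish g) x)"
    "path_image (g +++ linepath (pathfinish g) x) \<subseteq> U"
    "path_image (linepath (pathfinish g) x) \<subseteq> ball (pathfinish g) e"
proof -
  have "e > 0" using assms(4) zero_le_dist[of "pathfinish g" x] by (simp del: zero_le_dist)
  then show *: "path_image (linepath (pathfinish g) x) \<subseteq> ball (pathfinish g) e"
    using assms(4) by (simp add: closed_segment_subset)
  show "path (g +++ linepath (pathfinish g) x)" using assms(1) by simp
  show "path_image (g +++ linepath (pathfinish g) x) \<subseteq> U"
    using * assms(2,3) by (intro subset_path_image_join) auto
qed

lemma holomorphic_on_cover_lift_end:
  assumes "f holomorphic_on U"
  shows "holomorphic_on_cover U b (\<lambda>C. f (lift_end C))"
  unfolding holomorphic_on_cover_def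
proof (intro ballI allI impI)
  fix g e assume g: "g \<in> paths_from U b" and e: "0 < (e::real)" "ball (pathfinish g) e \<subseteq> U"
  have "f holomorphic_on ball (pathfinish g) e" using assms e(2) holomorphic_on_subset by blast
  then show "(\<lambda>x. f (lift_end (path_class U (g +++ linepath (pathfinish g) x))))
      holomorphic_on ball (pathfinish g) e"
  proof (rule holomorphic_transform)
    fix x assume x: "x \<in> ball (pathfinish g) e"
    show "f x = f (lift_end (path_class U (g +++ linepath (pathfinish g) x)))"
      using path_image_join_linepath_subset[OF _ _ e(2) x] g by (simp add: paths_from_def)
  qed
qed

lemma holomorphic_on_cover_lift_int:
  assumes "open U" "f holomorphic_on U"
  shows "holomorphic_on_cover U b (lift_int f)"
  unfolding holomorphic_on_cover_def
proof (intro ballI allI impI)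
  fix g e assume g: "g \<in> paths_from U b" and e: "0 < (e::real)" "ball (pathfinish g) e \<subseteq> U"
  let ?B = "ball (pathfinish g) e"
  have "f holomorphic_on ?B" using assms e(2) holomorphic_on_subset by blast
  then obtain P where "\<And>x. x \<in> ?B \<Longrightarrow> (P has_field_derivative f x) (at x within ?B)"
    using holomorphic_convex_primitive'[of ?B f] by auto
  then have P: "\<And>x. x \<in> ?B \<Longrightarrow> (P has_field_derivative f x) (at x)"
    by (metis at_within_open open_ball)
  then have "P holomorphic_on ?B"
    unfolding holomorphic_on_open[OF open_ball] using P by blast
  then have "(\<lambda>x. lift_int f (path_class U g) + (P x - P (pathfinish g))) holomorphic_on ?B"
    by (intro holomorphic_intros)
  then show "(\<lambda>x. lift_int f (path_class U (g +++ linepath (pathfinish g) x))) holomorphic_on ?B"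
  proof (rule holomorphic_transform)
    fix x assume x: "x \<in> ?B"
    show "lift_int f (path_class U g) + (P x - P (pathfinish g)) =
        lift_int f (path_class U (g +++ linepath (pathfinish g) x))"
      using lift_int_join[OF assms _ _ open_ball e(2) P, of g "linepath (pathfinish g) x"]
        path_image_join_linepath_subset(3)[OF _ _ e(2) x] g by (simp add: paths_from_def)
  qed
qed

lemma holomorphic_on_cover_add:
  "holomorphic_on_cover U b F \<Longrightarrow> holomorphic_on_cover U b G \<Longrightarrow>
    holomorphic_on_cover U b (\<lambda>C. F C + G C)"
  unfolding holomorphic_on_cover_def by (auto intro!: holomorphic_on_add)

lemma holomorphic_on_cover_mult:
  "holomorphic_on_cover U b F \<Longrightarrow> holomorphic_on_cover U b G \<Longrightarrow>
    holomorphic_on_cover U b (\<lambda>C. F C * G C)"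
  unfolding holomorphic_on_cover_def by (auto intro!: holomorphic_on_mult)

lemma holomorphic_on_cover_sum:
  "(\<And>i. i \<in> I \<Longrightarrow> holomorphic_on_cover U b (F i)) \<Longrightarrow>
    holomorphic_on_cover U b (\<lambda>C. \<Sum>i\<in>I. F i C)"
  unfolding holomorphic_on_cover_def by (auto intro!: holomorphic_on_sum)

subsection \<open>Expansions on the sheets at a puncture\<close>

text \<open>The matrix of \<^const>\<open>cover_singularity\<close>, with the radius exposed: expansions on a common disc can be added.\<close>

definition sheet_expansion where
  "sheet_expansion U b F p e n \<Lambda> \<longleftrightarrow>
    (\<forall>g \<in> paths_from U b. pathfinish g \<in> slit_ball p e \<longrightarrow>
      (\<exists>c h. h holomorphic_on ball p e \<and>
        (\<forall>d. path d \<and> path_image d \<subseteq> slit_ball p e \<and> pathstart d = pathfinish g \<longrightarrow>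
           F (path_class U (g +++ d)) =
             (\<Sum>k=1..n. c k / (pathfinish d - p) ^ k) + h (pathfinish d) + \<Lambda> (pathfinish d))))"

lemma cover_singularityI:
  assumes "e > 0" "ball p e - {p} \<subseteq> U" "sheet_expansion U b F p e n \<Lambda>"
  shows "cover_singularity U b F p n \<Lambda>"
  using assms unfolding cover_singularity_def sheet_expansion_def by blast

lemma slit_ball_subset: "slit_ball p e \<subseteq> ball p e - {p}"
  by (auto simp: slit_ball_def)

lemma open_slit_ball: "open (slit_ball p e)"
proof -
  have "slit_ball p e = ball p e \<inter> (\<lambda>x. x - p) -` (- \<real>\<^sub>\<le>\<^sub>0)" by (auto simp: slit_ball_def)
  moreover have "open ((\<lambda>x. x - p) -` (- \<real>\<^sub>\<le>\<^sub>0 :: complex set))"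
    by (intro open_vimage continuous_intros) (simp add: open_Compl)
  ultimately show ?thesis by auto
qed

lemma pathfinish_slit_ball:
  "path_image d \<subseteq> slit_ball p e \<Longrightarrow> pathfinish d \<in> slit_ball p e"
  using pathfinish_in_path_image by blast

text \<open>A holomorphic discrepancy between two forms of the singular term is absorbed by
  \<open>h\<close>. This will dispose of the polynomial multiple of \<open>ln (- c)\<close> that
  separates \<open>Ln (- \<mu>)\<close> from \<open>Ln (s - z)\<close>.\<close>

lemma sheet_expansion_cong:
  assumes F: "sheet_expansion U b F p e n \<Lambda>" and h0: "h0 holomorphic_on ball p e"
    and eq: "\<And>s. s \<in> slit_ball p e \<Longrightarrow> \<Lambda> s = h0 s + \<Lambda>' s"
  shows "sheet_expansion U b F p e n \<Lambda>'"
  unfolding sheet_expansion_def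
proof (intro ballI impI)
  fix g assume "g \<in> paths_from U b" "pathfinish g \<in> slit_ball p e"
  then obtain c h where h: "h holomorphic_on ball p e"
    and F': "\<And>d. path d \<Longrightarrow> path_image d \<subseteq> slit_ball p e \<Longrightarrow> pathstart d = pathfinish g \<Longrightarrow>
           F (path_class U (g +++ d)) =
             (\<Sum>k=1..n. c k / (pathfinish d - p) ^ k) + h (pathfinish d) + \<Lambda> (pathfinish d)"
    using F unfolding sheet_expansion_def by meson
  show "\<exists>c h. h holomorphic_on ball p e \<and>
        (\<forall>d. path d \<and> path_image d \<subseteq> slit_ball p e \<and> pathstart d = pathfinish g \<longrightarrow>
           F (path_class U (g +++ d)) =
             (\<Sum>k=1..n. c k / (pathfinish d - p) ^ k) + h (pathfinish d) + \<Lambda>' (pathfinish d))"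
    by (intro exI[of _ c] exI[of _ "\<lambda>s. h s + h0 s"] conjI holomorphic_on_add h h0 allI impI)
      (use F' eq pathfinish_slit_ball in simp)
qed

lemma sheet_expansion_add:
  assumes F: "sheet_expansion U b F p e n \<Lambda>" and G: "sheet_expansion U b G p e n \<Lambda>'"
  shows "sheet_expansion U b (\<lambda>C. F C + G C) p e n (\<lambda>s. \<Lambda> s + \<Lambda>' s)"
  unfolding sheet_expansion_def
proof (intro ballI impI)
  fix g assume g: "g \<in> paths_from U b" "pathfinish g \<in> slit_ball p e"
  obtain c h where h: "h holomorphic_on ball p e"
    and F': "\<And>d. path d \<Longrightarrow> path_image d \<subseteq> slit_ball p e \<Longrightarrow> pathstart d = pathfinish g \<Longrightarrow>
           F (path_class U (g +++ d)) =
             (\<Sum>k=1..n. c k / (pathfinish d - p) ^ k) + h (pathfinish d) + \<Lambda> (pathfinish d)"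
    using F g unfolding sheet_expansion_def by meson
  obtain c' h' where h': "h' holomorphic_on ball p e"
    and G': "\<And>d. path d \<Longrightarrow> path_image d \<subseteq> slit_ball p e \<Longrightarrow> pathstart d = pathfinish g \<Longrightarrow>
           G (path_class U (g +++ d)) =
             (\<Sum>k=1..n. c' k / (pathfinish d - p) ^ k) + h' (pathfinish d) + \<Lambda>' (pathfinish d)"
    using G g unfolding sheet_expansion_def by meson
  show "\<exists>c h. h holomorphic_on ball p e \<and>
        (\<forall>d. path d \<and> path_image d \<subseteq> slit_ball p e \<and> pathstart d = pathfinish g \<longrightarrow>
           F (path_class U (g +++ d)) + G (path_class U (g +++ d)) =
             (\<Sum>k=1..n. c k / (pathfinish d - p) ^ k) + h (pathfinish d) +
             (\<Lambda> (pathfinish d) + \<Lambda>' (pathfinish d)))"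
    by (intro exI[of _ "\<lambda>k. c k + c' k"] exI[of _ "\<lambda>s. h s + h' s"] conjI holomorphic_on_add h h' allI impI)
      (simp add: F' G' add_divide_distrib sum.distrib)
qed

lemma sheet_expansion_mono:
  assumes F: "sheet_expansion U b F p e m \<Lambda>" and "m \<le> n"
  shows "sheet_expansion U b F p e n \<Lambda>"
  unfolding sheet_expansion_def
proof (intro ballI impI)
  fix g assume g: "g \<in> paths_from U b" "pathfinish g \<in> slit_ball p e"
  obtain c h where h: "h holomorphic_on ball p e"
    and F': "\<And>d. path d \<Longrightarrow> path_image d \<subseteq> slit_ball p e \<Longrightarrow> pathstart d = pathfinish g \<Longrightarrow>
           F (path_class U (g +++ d)) =
             (\<Sum>k=1..m. c k / (pathfinish d - p) ^ k) + h (pathfinish d) + \<Lambda> (pathfinish d)"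
    using F g unfolding sheet_expansion_def by meson
  have "(\<Sum>k=1..n. (if k \<le> m then c k else 0) / w ^ k) = (\<Sum>k=1..m. c k / w ^ k)" for w :: complex
    using assms(2) by (intro sum.mono_neutral_cong_right) auto
  then show "\<exists>c h. h holomorphic_on ball p e \<and>
        (\<forall>d. path d \<and> path_image d \<subseteq> slit_ball p e \<and> pathstart d = pathfinish g \<longrightarrow>
           F (path_class U (g +++ d)) =
             (\<Sum>k=1..n. c k / (pathfinish d - p) ^ k) + h (pathfinish d) + \<Lambda> (pathfinish d))"
    by (intro exI[of _ "\<lambda>k. if k \<le> m then c k else 0"] exI[of _ h]) (simp add: F' h)
qed

text \<open>Taylor coefficients are peeled off one at a time:
  \<open>K s = K p + D s * (s - p)\<close>, where the difference quotient \<open>D\<close> is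
  holomorphic by removal of the singularity. The value \<open>K p\<close> is the coefficient of
  highest order, and \<open>D\<close> takes the place of \<open>K\<close> at the next lower
  order.\<close>

lemma holomorphic_quotient_polar_part:
  assumes "K holomorphic_on ball p e"
  shows "\<exists>c h. h holomorphic_on ball p e \<and>
    (\<forall>s \<in> ball p e - {p}. K s / (s - p) ^ n = (\<Sum>k=1..n. c k / (s - p) ^ k) + h s)"
  using assms
proof (induction n arbitrary: K)
  case 0
  then show ?case by auto
next
  case (Suc n)
  define D where "D = (\<lambda>s. if s = p then deriv K p else (K s - K p) / (s - p))"
  have "D holomorphic_on ball p e" unfolding D_def using Suc.prems by (intro pole_lemma_open) auto
  then obtain c h where h: "h holomorphic_on ball p e"
    "\<And>s. s \<in> ball p e - {p} \<Longrightarrow> D s / (s - p) ^ n = (\<Sum>k=1..n. c k / (s - p) ^ k) + h s"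
    using Suc.IH by blast
  have "K s / (s - p) ^ Suc n = (\<Sum>k=1..Suc n. (c(Suc n := K p)) k / (s - p) ^ k) + h s"
    if s: "s \<in> ball p e - {p}" for s
  proof -
    have "s - p \<noteq> 0" using s by auto
    then have "K s = K p + D s * (s - p)" by (simp add: D_def)
    then have "K s / (s - p) ^ Suc n = K p / (s - p) ^ Suc n + D s * (s - p) / (s - p) ^ Suc n"
      by (simp only: add_divide_distrib)
    also have "D s * (s - p) / (s - p) ^ Suc n = D s / (s - p) ^ n"
      unfolding power_Suc2 by (rule nonzero_mult_divide_mult_cancel_right) fact
    finally have "K s / (s - p) ^ Suc n = K p / (s - p) ^ Suc n + D s / (s - p) ^ n" .
    moreover have "(\<Sum>k=1..n. (c(Suc n := K p)) k / (s - p) ^ k) = (\<Sum>k=1..n. c k / (s - p) ^ k)"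
      by (intro sum.cong) auto
    then have "(\<Sum>k=1..Suc n. (c(Suc n := K p)) k / (s - p) ^ k) =
        (\<Sum>k=1..n. c k / (s - p) ^ k) + K p / (s - p) ^ Suc n"
      by simp
    ultimately show ?thesis using h(2)[OF s] by simp
  qed
  then show ?case using h(1) by blast
qed

lemma sheet_expansion_lift_end:
  assumes U: "ball p e - {p} \<subseteq> U" and K: "K holomorphic_on ball p e"
    and f: "\<And>s. s \<in> ball p e - {p} \<Longrightarrow> f s = K s / (s - p) ^ n"
  shows "sheet_expansion U b (\<lambda>C. f (lift_end C)) p e n (\<lambda>_. 0)"
proof -
  obtain c h where h: "h holomorphic_on ball p e"
    "\<And>s. s \<in> ball p e - {p} \<Longrightarrow> K s / (s - p) ^ n = (\<Sum>k=1..n. c k / (s - p) ^ k) + h s"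
    using holomorphic_quotient_polar_part[OF K, of n] by blast
  have "f (lift_end (path_class U (g +++ d))) =
      (\<Sum>k=1..n. c k / (pathfinish d - p) ^ k) + h (pathfinish d) + 0"
    if "g \<in> paths_from U b" "path d" "path_image d \<subseteq> slit_ball p e" "pathstart d = pathfinish g" for g d
  proof -
    have "path_image d \<subseteq> U" using that U slit_ball_subset by blast
    then have "lift_end (path_class U (g +++ d)) = pathfinish d"
      using that by (subst lift_end_path_class) (auto simp: paths_from_def path_image_join)
    moreover have "pathfinish d \<in> ball p e - {p}"
      using that pathfinish_slit_ball slit_ball_subset by blast
    ultimately show ?thesis using h(2)[of "pathfinish d"] f[of "pathfinish d"] by simp
  qed
  then show ?thesis unfolding sheet_expansion_def using h(1) by blast
qed

text \<open>A polar part would have to be re-expanded after multiplication by \<open>A\<close>. At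
  order 0 the factor simply multiplies \<open>h\<close> and \<Lambda>.\<close>

lemma sheet_expansion_mult_lift_end:
  assumes U: "ball p e - {p} \<subseteq> U" and A: "A holomorphic_on ball p e"
    and F: "sheet_expansion U b F p e 0 \<Lambda>"
  shows "sheet_expansion U b (\<lambda>C. A (lift_end C) * F C) p e 0 (\<lambda>s. A s * \<Lambda> s)"
  unfolding sheet_expansion_def
proof (intro ballI impI)
  fix g assume g: "g \<in> paths_from U b" "pathfinish g \<in> slit_ball p e"
  obtain h where h: "h holomorphic_on ball p e"
    and F': "\<And>d. path d \<Longrightarrow> path_image d \<subseteq> slit_ball p e \<Longrightarrow> pathstart d = pathfinish g \<Longrightarrow>
           F (path_class U (g +++ d)) = h (pathfinish d) + \<Lambda> (pathfinish d)"
    using F g unfolding sheet_expansion_def by fastforce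
  have "A (lift_end (path_class U (g +++ d))) * F (path_class U (g +++ d)) =
      (\<Sum>k=1..0. 0 / (pathfinish d - p) ^ k) + A (pathfinish d) * h (pathfinish d) +
      A (pathfinish d) * \<Lambda> (pathfinish d)"
    if d: "path d" "path_image d \<subseteq> slit_ball p e" "pathstart d = pathfinish g" for d
  proof -
    have "path_image d \<subseteq> U" using d U slit_ball_subset by blast
    then have "lift_end (path_class U (g +++ d)) = pathfinish d"
      using d g by (subst lift_end_path_class) (auto simp: paths_from_def path_image_join)
    then show ?thesis using F'[OF d] by (simp add: distrib_left)
  qed
  then show "\<exists>c h. h holomorphic_on ball p e \<and>
        (\<forall>d. path d \<and> path_image d \<subseteq> slit_ball p e \<and> pathstart d = pathfinish g \<longrightarrow>
           A (lift_end (path_class U (g +++ d))) * F (path_class U (g +++ d)) =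
             (\<Sum>k=1..0. c k / (pathfinish d - p) ^ k) + h (pathfinish d) +
             A (pathfinish d) * \<Lambda> (pathfinish d))"
    using A h by (intro exI[of _ "\<lambda>_. 0"] exI[of _ "\<lambda>s. A s * h s"]) (auto intro: holomorphic_on_mult)
qed

lemma sheet_expansion_zero: "sheet_expansion U b (\<lambda>_. 0) p e n (\<lambda>_. 0)"
  unfolding sheet_expansion_def
  by (intro ballI impI exI[of _ "\<lambda>_. 0"]) simp

lemma sheet_expansion_sum:
  assumes "\<And>i. i \<in> I \<Longrightarrow> sheet_expansion U b (F i) p e n (\<Lambda> i)"
  shows "sheet_expansion U b (\<lambda>C. \<Sum>i\<in>I. F i C) p e n (\<lambda>s. \<Sum>i\<in>I. \<Lambda> i s)"
  using assms
  by (induction I rule: infinite_finite_induct)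
    (auto intro: sheet_expansion_zero sheet_expansion_add)

text \<open>Splitting \<open>K s / (s - p)\<close> into \<open>K p / (s - p)\<close> and a
  holomorphic rest gives the primitive \<open>K p * Ln (s - p) + H s\<close> on the slit disc.
  Changing the sheet changes only the additive constant, so the residue \<open>K p\<close> is the
  coefficient of the logarithm on all of them.\<close>

lemma sheet_expansion_lift_int:
  assumes U: "open U" "f holomorphic_on U" "ball p e - {p} \<subseteq> U"
    and K: "K holomorphic_on ball p e"
    and f: "\<And>s. s \<in> ball p e - {p} \<Longrightarrow> f s = K s / (s - p)"
  shows "sheet_expansion U b (lift_int f) p e 0 (\<lambda>s. K p * Ln (s - p))"
proof -
  define D where "D = (\<lambda>s. if s = p then deriv K p else (K s - K p) / (s - p))"
  have "D holomorphic_on ball p e" unfolding D_def using K by (intro pole_lemma_open) auto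
  then obtain H where "\<And>x. x \<in> ball p e \<Longrightarrow> (H has_field_derivative D x) (at x within ball p e)"
    using holomorphic_convex_primitive'[of "ball p e" D] by auto
  then have H: "\<And>x. x \<in> ball p e \<Longrightarrow> (H has_field_derivative D x) (at x)"
    by (metis at_within_open open_ball)
  define P where "P = (\<lambda>s. K p * Ln (s - p) + H s)"
  have P: "(P has_field_derivative f s) (at s)" if s: "s \<in> slit_ball p e" for s
  proof -
    have s': "s \<in> ball p e" "s \<noteq> p" "s - p \<notin> \<real>\<^sub>\<le>\<^sub>0" using s slit_ball_subset by (auto simp: slit_ball_def)
    have "(P has_field_derivative K p * (1 / (s - p)) + D s) (at s)"
      unfolding P_def using s' H by (auto intro!: derivative_eq_intros simp: field_simps)
    moreover have "K p * (1 / (s - p)) + D s = f s"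
      using s' f[of s] by (simp add: D_def add_divide_distrib[symmetric])
    ultimately show ?thesis by simp
  qed
  have sub: "slit_ball p e \<subseteq> U" using U slit_ball_subset by blast
  have Hh: "H holomorphic_on ball p e" unfolding holomorphic_on_open[OF open_ball] using H by blast
  show ?thesis unfolding sheet_expansion_def
  proof (intro ballI impI)
    fix g assume g: "g \<in> paths_from U b" "pathfinish g \<in> slit_ball p e"
    \<comment> \<open>The only quantity that depends on the sheet: the integral along
      \<open>g\<close>, adjusted by the value of the primitive where the slit disc is
      entered.\<close>
    let ?k = "lift_int f (path_class U g) - P (pathfinish g)"
    have "lift_int f (path_class U (g +++ d)) = (\<Sum>k=1..0. 0 / (pathfinish d - p) ^ k) +
        (H (pathfinish d) + ?k) + K p * Ln (pathfinish d - p)"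
      if d: "path d" "path_image d \<subseteq> slit_ball p e" "pathstart d = pathfinish g" for d
      using lift_int_join[OF U(1,2) _ _ open_slit_ball sub P d] g d(3)
      by (simp add: paths_from_def P_def)
    then show "\<exists>c h. h holomorphic_on ball p e \<and>
        (\<forall>d. path d \<and> path_image d \<subseteq> slit_ball p e \<and> pathstart d = pathfinish g \<longrightarrow>
           lift_int f (path_class U (g +++ d)) =
             (\<Sum>k=1..0. c k / (pathfinish d - p) ^ k) + h (pathfinish d) + K p * Ln (pathfinish d - p))"
      using Hh by (intro exI[of _ "\<lambda>_. 0"] exI[of _ "\<lambda>s. H s + ?k"]) (auto intro!: holomorphic_intros)
  qed
qed

subsection \<open>Polylogarithms of exponentials\<close>

lemma summable_norm_polylog:
  fixes x :: complex
  assumes "norm x < 1"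
  shows "summable (\<lambda>l. norm (x ^ Suc l / of_nat (Suc l) ^ m))"
proof (rule summable_comparison_test')
  show "summable (\<lambda>l. norm x ^ Suc l)"
    unfolding summable_Suc_iff using assms by (intro summable_geometric) simp
  fix l :: nat
  have "norm (x ^ Suc l / of_nat (Suc l) ^ m) = norm x ^ Suc l / real (Suc l) ^ m"
    by (simp add: norm_divide norm_mult norm_power del: of_nat_Suc)
  also have "\<dots> \<le> norm x ^ Suc l"
    using divide_left_mono[of 1 "real (Suc l) ^ m" "norm x ^ Suc l"] one_le_power[of "real (Suc l)" m]
    by simp
  finally show "norm (norm (x ^ Suc l / of_nat (Suc l) ^ m)) \<le> norm x ^ Suc l" by simp
qed

lemma summable_polylog:
  fixes x :: complex
  shows "norm x < 1 \<Longrightarrow> summable (\<lambda>l. x ^ Suc l / of_nat (Suc l) ^ m)"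
  by (rule summable_norm_cancel) (rule summable_norm_polylog)

lemma polylog_0: "norm x < 1 \<Longrightarrow> polylog 0 x = x / (1 - x)"
  by (simp add: polylog_def suminf_mult suminf_geometric)

text \<open>Termwise, \<open>x\<close> times the derivative of \<open>Li_(m+1)\<close> at
  \<open>x\<close> is \<open>Li_m(x)\<close>; the inner derivative of \<open>exp (c * s)\<close>
  contributes exactly this factor \<open>x\<close>, along with \<open>c\<close>.\<close>

lemma has_field_derivative_polylog_exp:
  assumes "norm (exp (c * s)) < 1"
  shows "((\<lambda>s. polylog (Suc m) (exp (c * s))) has_field_derivative c * polylog m (exp (c * s))) (at s)"
proof -
  \<comment> \<open>The polylogarithm starts at exponent 1. A vanishing coefficient at 0 makes it an
    ordinary power series, to which termwise differentiation applies.\<close>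
  define a :: "nat \<Rightarrow> complex" where "a n = (if n = 0 then 0 else 1 / of_nat n ^ Suc m)" for n
  have a: "(\<lambda>l. x ^ Suc l / of_nat (Suc l) ^ Suc m) = (\<lambda>l. a (Suc l) * x ^ Suc l)" for x
    by (simp add: a_def)
  have sm: "summable (\<lambda>n. a n * x ^ n)" if "norm x < 1" for x
    using summable_polylog[OF that, of "Suc m"] unfolding a by (subst (asm) summable_Suc_iff)
  have eq: "polylog (Suc m) x = suminf (\<lambda>n. a n * x ^ n)" if "norm x < 1" for x
    using suminf_split_head[OF sm[OF that]] unfolding polylog_def a by (simp add: a_def)
  have "diffs a n = 1 / of_nat (Suc n) ^ m" for n
    by (simp add: diffs_def a_def del: of_nat_Suc)
  then have "((\<lambda>x. suminf (\<lambda>n. a n * x ^ n)) has_field_derivative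
      suminf (\<lambda>n. 1 / of_nat (Suc n) ^ m * exp (c * s) ^ n)) (at (exp (c * s)))"
    using termdiffs_strong'[of 1 a, OF sm assms] by simp
  then have "(polylog (Suc m) has_field_derivative
      suminf (\<lambda>n. 1 / of_nat (Suc n) ^ m * exp (c * s) ^ n)) (at (exp (c * s)))"
    by (rule DERIV_cong_ev[OF refl _ refl, THEN iffD1, rotated])
      (use assms eventually_nhds_in_open[of "ball 0 1" "exp (c * s)"] eq
        in \<open>auto elim!: eventually_mono\<close>)
  moreover have "((\<lambda>s. exp (c * s)) has_field_derivative c * exp (c * s)) (at s)"
    by (auto intro!: derivative_eq_intros)
  ultimately have "((\<lambda>s. polylog (Suc m) (exp (c * s))) has_field_derivative
      suminf (\<lambda>n. 1 / of_nat (Suc n) ^ m * exp (c * s) ^ n) * (c * exp (c * s))) (at s)"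
    by (rule DERIV_chain2)
  moreover have "polylog m (exp (c * s)) =
      (suminf (\<lambda>n. exp (c * s) * (1 / of_nat (Suc n) ^ m * exp (c * s) ^ n)))"
    unfolding polylog_def by (intro arg_cong[where f = suminf] ext) simp
  moreover have "\<dots> = exp (c * s) * suminf (\<lambda>n. 1 / of_nat (Suc n) ^ m * exp (c * s) ^ n)"
  proof (rule suminf_mult)
    have "summable (\<lambda>n. exp (c * s) * (1 / of_nat (Suc n) ^ m * exp (c * s) ^ n))"
      using summable_polylog[OF assms, of m] by (simp add: field_simps del: of_nat_Suc)
    then show "summable (\<lambda>n. 1 / of_nat (Suc n) ^ m * exp (c * s) ^ n)"
      by (rule summable_mult_D) simp
  qed
  ultimately show ?thesis by (simp add: mult_ac)
qed

section \<open>Repeated primitives of \<open>Li_0 (exp (c * s))\<close>\<close>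

definition phi :: "complex \<Rightarrow> complex \<Rightarrow> complex" where
  "phi c s = exp (c * s) / (1 - exp (c * s))"

text \<open>The coefficient of $t^k$ in $c^{n+1}(s-t)^n/n!$, the kernel of $(n+1)$-fold integration.\<close>

definition kernel_coeff :: "complex \<Rightarrow> nat \<Rightarrow> nat \<Rightarrow> complex \<Rightarrow> complex" where
  "kernel_coeff c n k s = c ^ Suc n * (- 1) ^ k * s ^ (n - k) / (fact k * fact (n - k))"

lemma holomorphic_kernel_coeff: "kernel_coeff c n k holomorphic_on S"
  unfolding kernel_coeff_def by (intro holomorphic_intros) auto

lemma sum_kernel_coeff:
  "(\<Sum>k\<le>n. kernel_coeff c n k s * t ^ k) = c ^ Suc n * (s - t) ^ n / fact n"
proof -
  have "(s - t) ^ n = (\<Sum>k\<le>n. of_nat (n choose k) * (- t) ^ k * s ^ (n - k))"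
    using binomial_ring[of "- t" s n] by simp
  also have "c ^ Suc n * \<dots> / fact n = (\<Sum>k\<le>n. kernel_coeff c n k s * t ^ k)"
    unfolding sum_distrib_left sum_divide_distrib
  proof (intro sum.cong refl)
    fix k assume "k \<in> {..n}"
    then have *: "of_nat (n choose k) = (fact n / (fact k * fact (n - k)) :: complex)"
      by (simp add: binomial_fact)
    have "(- t) ^ k = (- 1) ^ k * t ^ k" using power_mult_distrib[of "- 1" t k] by simp
    then show "c ^ Suc n * (of_nat (n choose k) * (- t) ^ k * s ^ (n - k)) / fact n =
        kernel_coeff c n k s * t ^ k"
      unfolding * kernel_coeff_def by simp
  qed
  finally show ?thesis by simp
qed

lemma has_field_derivative_kernel_coeff:
  "k \<le> n \<Longrightarrow> (kernel_coeff c (Suc n) k has_field_derivative c * kernel_coeff c n k s) (at s)"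
proof -
  assume "k \<le> n"
  then have f: "Suc n - k = Suc (n - k)" by simp
  have "((\<lambda>s. c ^ Suc (Suc n) * (- 1) ^ k * s ^ Suc (n - k) / (fact k * fact (Suc (n - k))))
     has_field_derivative
     c ^ Suc (Suc n) * (- 1) ^ k * (of_nat (Suc (n - k)) * s ^ (n - k)) / (fact k * fact (Suc (n - k))))
     (at s)"
    by (intro DERIV_cdivide DERIV_cmult) (auto intro!: derivative_eq_intros simp del: of_nat_Suc power_Suc)
  moreover have "c ^ Suc (Suc n) * (- 1) ^ k * (of_nat (Suc (n - k)) * s ^ (n - k)) /
      (fact k * fact (Suc (n - k))) = c * kernel_coeff c n k s"
    by (simp add: kernel_coeff_def fact_Suc del: of_nat_Suc)
  ultimately show ?thesis unfolding kernel_coeff_def[abs_def] f by simp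
qed

text \<open>Keeps the correction term entire through the induction below: \<open>f\<close> lives on
  \<open>H\<close> only, but differs there by a constant from a global primitive of its entire
  derivative.\<close>

lemma holomorphic_primitive_difference:
  assumes H: "open H" "convex H" and E: "E holomorphic_on UNIV"
    and f: "\<And>s. s \<in> H \<Longrightarrow> (f has_field_derivative E s) (at s)"
  obtains B where "B holomorphic_on UNIV" "\<And>s. s \<in> H \<Longrightarrow> f s = B s"
proof -
  obtain B where B: "\<And>s. (B has_field_derivative E s) (at s)"
    using holomorphic_convex_primitive'[of UNIV E] E by auto
  have "((\<lambda>s. f s - B s) has_field_derivative 0) (at s within H)" if "s \<in> H" for s
    using DERIV_diff[OF f[OF that] B[of s]] by (auto intro: has_field_derivative_at_within)
  then obtain k where k: "\<And>s. s \<in> H \<Longrightarrow> f s - B s = k"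
    using has_field_derivative_zero_constant[OF H(2), of "\<lambda>s. f s - B s"] by blast
  have "(\<lambda>s. B s + k) holomorphic_on UNIV"
    using B by (intro holomorphic_intros) (auto simp: holomorphic_on_open)
  then show ?thesis using that[of "\<lambda>s. B s + k"] k by (simp add: algebra_simps)
qed

text \<open>
  Iterating $\frac{d}{ds}\mathrm{Li}_m(e^{cs}) = c\,\mathrm{Li}_{m-1}(e^{cs})$ down to the single-valued
  $\mathrm{Li}_0$ leaves only primitives \<open>P k\<close> of $t^k \mathrm{Li}_0(e^{ct})$, whose continuation is path integration.
\<close>

lemma polylog_exp_eq_primitives:
  fixes c :: complex
  assumes H: "open H" "convex H" "\<And>s. s \<in> H \<Longrightarrow> norm (exp (c * s)) < 1"
    and P: "\<And>k s. s \<in> H \<Longrightarrow> (P k has_field_derivative s ^ k * phi c s) (at s)"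
  shows "\<exists>B. B holomorphic_on UNIV \<and> (\<forall>s\<in>H. polylog (Suc n) (exp (c * s)) =
    B s + (\<Sum>k\<le>n. kernel_coeff c n k s * P k s))"
proof (induction n)
  case 0
  have "((\<lambda>s. polylog (Suc 0) (exp (c * s)) - c * P 0 s) has_field_derivative 0) (at s)"
    if s: "s \<in> H" for s
    using DERIV_diff[OF has_field_derivative_polylog_exp[OF H(3)[OF s], of 0]
        DERIV_cmult[OF P[OF s, of 0], of c]] polylog_0[OF H(3)[OF s]]
    by (simp add: phi_def)
  then obtain B where "B holomorphic_on UNIV"
    "\<And>s. s \<in> H \<Longrightarrow> polylog (Suc 0) (exp (c * s)) - c * P 0 s = B s"
    using holomorphic_primitive_difference[OF H(1,2), of "\<lambda>_. 0"] by auto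
  then show ?case
    by (intro exI[of _ B]) (auto simp: kernel_coeff_def algebra_simps)
next
  case (Suc n)
  then obtain B where B: "B holomorphic_on UNIV" "\<And>s. s \<in> H \<Longrightarrow> polylog (Suc n) (exp (c * s)) =
    B s + (\<Sum>k\<le>n. kernel_coeff c n k s * P k s)" by blast
  let ?K = "kernel_coeff c (Suc n)"
  have der: "((\<lambda>s. polylog (Suc (Suc n)) (exp (c * s)) - (\<Sum>k\<le>Suc n. ?K k s * P k s))
      has_field_derivative c * B s) (at s)" if s: "s \<in> H" for s
  proof -
    have "((\<lambda>s. \<Sum>k\<le>Suc n. ?K k s * P k s) has_field_derivative
      (\<Sum>k\<le>Suc n. (if k \<le> n then c * kernel_coeff c n k s else 0) * P k s
          + s ^ k * phi c s * ?K k s)) (at s)"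
    proof (intro DERIV_sum DERIV_mult P[OF s])
      fix k assume "k \<in> {..Suc n}"
      moreover have "(?K (Suc n) has_field_derivative 0) (at s)"
        by (simp add: kernel_coeff_def[abs_def])
      ultimately show "(?K k has_field_derivative (if k \<le> n then c * kernel_coeff c n k s else 0)) (at s)"
        using has_field_derivative_kernel_coeff[of k n c s] by (auto simp: le_Suc_eq)
    qed
    \<comment> \<open>The derivatives falling on the \<open>P k\<close> assemble the kernel at
      \<open>t = s\<close>, which vanishes since its degree \<open>Suc n\<close> is positive. Only
      the derivatives of the kernel coefficients survive, and these lower the degree by one.\<close>
    moreover have "(\<Sum>k\<le>Suc n. s ^ k * phi c s * ?K k s) = phi c s * (\<Sum>k\<le>Suc n. ?K k s * s ^ k)"
      unfolding sum_distrib_left by (intro sum.cong) (auto simp: mult_ac)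
    moreover have "\<dots> = 0" unfolding sum_kernel_coeff by simp
    moreover have "(\<Sum>k\<le>Suc n. (if k \<le> n then c * kernel_coeff c n k s else 0) * P k s) =
        c * (\<Sum>k\<le>n. kernel_coeff c n k s * P k s)"
      by (simp add: sum_distrib_left mult_ac)
    ultimately have "((\<lambda>s. \<Sum>k\<le>Suc n. ?K k s * P k s) has_field_derivative
        c * (\<Sum>k\<le>n. kernel_coeff c n k s * P k s)) (at s)"
      unfolding sum.distrib by (simp only: add_0_right)
    from DERIV_diff[OF has_field_derivative_polylog_exp[OF H(3)[OF s], of "Suc n"] this]
    show ?thesis unfolding B(2)[OF s] by (simp only: distrib_left add_diff_cancel_right')
  qed
  have "(\<lambda>s. c * B s) holomorphic_on UNIV" using B(1) by (intro holomorphic_intros)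
  then obtain B' where "B' holomorphic_on UNIV"
    "\<And>s. s \<in> H \<Longrightarrow> polylog (Suc (Suc n)) (exp (c * s)) - (\<Sum>k\<le>Suc n. ?K k s * P k s) = B' s"
    by (rule holomorphic_primitive_difference[OF H(1,2) _ der]) blast+
  then show ?case by (intro exI[of _ B']) (auto simp: algebra_simps)
qed

section \<open>The simple zero of \<open>1 - exp (c * s)\<close> at a puncture\<close>

definition exp_quot :: "complex \<Rightarrow> complex" where
  "exp_quot w = (if w = 0 then 1 else (exp w - 1) / w)"

lemma exp_quot_0 [simp]: "exp_quot 0 = 1" by (simp add: exp_quot_def)

lemma exp_eq_exp_quot: "exp w = 1 + w * exp_quot w" by (simp add: exp_quot_def)

lemma holomorphic_exp_quot: "exp_quot holomorphic_on S"
proof -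
  have "(\<lambda>z::complex. if z = 0 then deriv exp 0 else (exp z - exp 0) / (z - 0)) holomorphic_on UNIV"
    by (intro pole_lemma_open holomorphic_on_exp' holomorphic_on_ident) auto
  moreover have "deriv exp (0::complex) = 1" using DERIV_exp[of "0::complex"] by (simp add: DERIV_imp_deriv)
  ultimately have "exp_quot holomorphic_on UNIV"
    unfolding exp_quot_def[abs_def] by (simp cong: if_cong)
  then show ?thesis using holomorphic_on_subset by blast
qed

lemma exp_eq_1_imp_zero:
  fixes w :: complex
  assumes "norm w < 2 * pi" "exp w = 1"
  shows "w = 0"
proof -
  obtain n :: int where n: "Re w = 0" "Im w = of_int (2 * n) * pi" using assms(2) exp_eq_1 by blast
  have "\<bar>Im w\<bar> < 2 * pi" using abs_Im_le_cmod[of w] assms(1) by linarith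
  then have "\<bar>of_int n :: real\<bar> * (2 * pi) < 1 * (2 * pi)" using n by (simp add: abs_mult)
  then have "\<bar>of_int n :: real\<bar> < 1" by (rule mult_right_less_imp_less) simp
  then have "n = 0" by linarith
  then show ?thesis using n by (simp add: complex_eq_iff)
qed

text \<open>The zeros of \<open>exp w - 1\<close> nearest to 0, apart from 0 itself, lie at distance
  \<open>2 * pi\<close>. Up to there \<open>exp_quot\<close> may be divided by, and the pole stays
  explicit as a power of \<open>s - z\<close>.\<close>

lemma exp_quot_nonzero: "norm w < 2 * pi \<Longrightarrow> exp_quot w \<noteq> 0"
  using exp_eq_1_imp_zero[of w] by (auto simp: exp_quot_def)

text \<open>Differentiating \<open>exp w = 1 + w * exp_quot w\<close> twice at 0 gives
  \<open>1 = 2 * deriv exp_quot 0\<close>. The value enters the coefficient of \<open>1 / s\<close>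
  of the first term.\<close>

lemma deriv_exp_quot_0: "(exp_quot has_field_derivative 1 / 2) (at 0)"
proof -
  have d: "(exp_quot has_field_derivative deriv exp_quot w) (at w)" for w
    using holomorphic_exp_quot holomorphic_derivI[of exp_quot UNIV w] by auto
  have "(deriv exp_quot) holomorphic_on UNIV"
    by (intro holomorphic_deriv holomorphic_exp_quot) auto
  then have d2: "(deriv exp_quot has_field_derivative deriv (deriv exp_quot) w) (at w)" for w
    using holomorphic_derivI[of "deriv exp_quot" UNIV w] by auto
  have "((\<lambda>w. 1 + w * exp_quot w) has_field_derivative exp_quot w + w * deriv exp_quot w) (at w)" for w
    using d by (auto intro!: derivative_eq_intros)
  then have e1: "exp w = exp_quot w + w * deriv exp_quot w" for w
    using DERIV_exp[of w] unfolding exp_eq_exp_quot[abs_def, symmetric] by (rule DERIV_unique[rotated])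
  have "((\<lambda>w. exp_quot w + w * deriv exp_quot w) has_field_derivative 2 * deriv exp_quot 0) (at 0)"
    by (auto intro!: derivative_eq_intros d d2)
  then have "(exp has_field_derivative 2 * deriv exp_quot 0) (at 0)"
    unfolding e1[abs_def, symmetric] .
  then have "2 * deriv exp_quot 0 = 1" using DERIV_exp[of "0::complex"] DERIV_unique by fastforce
  then have "deriv exp_quot 0 = 1 / 2" by (simp add: eq_divide_eq mult.commute)
  from d[of 0] show ?thesis unfolding \<open>deriv exp_quot 0 = 1 / 2\<close> .
qed

lemma one_minus_exp_eq_exp_quot:
  assumes "exp (c * z) = 1"
  shows "1 - exp (c * s) = - c * (s - z) * exp_quot (c * (s - z))"
proof -
  have "exp (c * s) = exp (c * (s - z)) * exp (c * z)"
    by (simp add: exp_add[symmetric] algebra_simps)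
  then show ?thesis using assms exp_eq_exp_quot[of "c * (s - z)"] by simp
qed

text \<open>\<open>2 * pi / norm c\<close> is the spacing of the solutions of
  \<open>exp (c * s) = 1\<close>, a radius common to all punctures and all terms.\<close>

lemma exp_quot_nonzero_ball:
  assumes "c \<noteq> 0" "s \<in> ball z (2 * pi / norm c)"
  shows "exp_quot (c * (s - z)) \<noteq> 0"
proof (rule exp_quot_nonzero)
  have "norm (s - z) < 2 * pi / norm c"
    using assms(2) by (simp add: dist_norm norm_minus_commute)
  then show "norm (c * (s - z)) < 2 * pi"
    using assms(1) by (simp add: norm_mult pos_less_divide_eq mult.commute)
qed

lemma exp_ne_1_punctured_ball:
  fixes c :: complex
  assumes "exp (c * z) = 1" "c \<noteq> 0" "s \<in> ball z (2 * pi / norm c) - {z}"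
  shows "exp (c * s) \<noteq> 1"
  using one_minus_exp_eq_exp_quot[OF assms(1), of s] exp_quot_nonzero_ball[OF assms(2), of s z] assms(2,3)
  by auto

lemma holomorphic_exp_quot_shift [holomorphic_intros]:
  "(\<lambda>s. exp_quot (c * (s - z))) holomorphic_on S"
proof -
  have "(exp_quot \<circ> (\<lambda>s. c * (s - z))) holomorphic_on S"
    by (intro holomorphic_on_compose holomorphic_exp_quot holomorphic_intros)
  then show ?thesis by (simp add: o_def)
qed

text \<open>The numerator of \<open>phi c\<close> over its simple pole at a puncture
  \<open>z\<close>. Its value \<open>- 1 / c\<close> there is the residue, from which the minus sign
  of Jonquiere's logarithm comes.\<close>

definition phi_num :: "complex \<Rightarrow> complex \<Rightarrow> complex \<Rightarrow> complex" where
  "phi_num c z s = - exp (c * s) / (c * exp_quot (c * (s - z)))"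

lemma holomorphic_phi_num:
  "c \<noteq> 0 \<Longrightarrow> phi_num c z holomorphic_on ball z (2 * pi / norm c)"
  unfolding phi_num_def[abs_def]
  by (intro holomorphic_intros) (use exp_quot_nonzero_ball in auto)

lemma phi_num_pole: "exp (c * z) = 1 \<Longrightarrow> phi_num c z z = - 1 / c"
  by (simp add: phi_num_def)

lemma phi_eq_phi_num:
  assumes "exp (c * z) = 1"
  shows "phi c s = phi_num c z s / (s - z)"
  unfolding phi_def phi_num_def one_minus_exp_eq_exp_quot[OF assms] by (simp add: mult_ac)

section \<open>Continuation of the polylogarithms to the cover\<close>

lemma open_exp_ne_1: "open (- {s. exp (c * s) = (1::complex)})"
proof -
  have "closed ((\<lambda>s. exp (c * s)) -` {1})"
    by (intro closed_vimage continuous_intros)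
  then show ?thesis by (simp add: vimage_def open_Compl)
qed

lemma holomorphic_phi: "phi c holomorphic_on - {s. exp (c * s) = 1}"
  unfolding phi_def[abs_def] by (intro holomorphic_intros) auto

text \<open>For \<open>c < 0\<close> the number \<open>- c * w\<close> is a positive multiple of
  \<open>w\<close>, so the principal logarithms differ by the real constant \<open>ln (- c)\<close>
  without any jump of the argument.\<close>

lemma jonquiere_log_Suc_scaled:
  assumes c: "c < 0" and w: "w \<notin> \<real>\<^sub>\<le>\<^sub>0"
  shows "jonquiere_log (Suc n) (of_real c * w) =
    - ((of_real c * w) ^ n / fact n) * of_real (ln (- c)) - (of_real c * w) ^ n / fact n * Ln w"
proof -
  have w0: "w \<noteq> 0" using w by auto
  have "- (of_real c * w) = of_real (- c) * w" by simp
  then have "Ln (- (of_real c * w)) = of_real (ln (- c)) + Ln w"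
    using Ln_times_of_real[of "- c" w] Ln_of_real[of "- c"] c w0 by (simp only:) simp
  then show ?thesis by (simp add: jonquiere_log_def algebra_simps add_divide_distrib)
qed

text \<open>On a convex \<open>H\<close> the function \<open>f\<close> has a primitive, and the
  integral along the segment from \<open>b\<close> is its increment; \<open>H\<close> is thereby
  lifted to the cover as one sheet.\<close>

lemma lift_int_linepath_has_field_derivative:
  assumes U: "open U" "f holomorphic_on U" and H: "open H" "convex H" "H \<subseteq> U" "b \<in> H" "s \<in> H"
  shows "((\<lambda>s. lift_int f (path_class U (linepath b s))) has_field_derivative f s) (at s)"
proof -
  obtain P where "\<And>x. x \<in> H \<Longrightarrow> (P has_field_derivative f x) (at x within H)"
    using holomorphic_convex_primitive'[OF H(2,1)] holomorphic_on_subset[OF U(2) H(3)] by blast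
  then have P: "\<And>x. x \<in> H \<Longrightarrow> (P has_field_derivative f x) (at x)"
    by (metis at_within_open H(1))
  have "lift_int f (path_class U (linepath b x)) = P x - P b" if "x \<in> H" for x
    using lift_int_primitive[OF U H(1,3) P, of "linepath b x"] closed_segment_subset[OF H(4) that H(2)]
    by simp
  moreover have "((\<lambda>x. P x - P b) has_field_derivative f s) (at s)"
    using P[OF H(5)] by (auto intro!: derivative_eq_intros)
  ultimately show ?thesis
    using has_field_derivative_transform_within_open[OF _ H(1,5)] by force
qed

lemma lift_end_halfplane:
  assumes "{s. Re s > 0} \<subseteq> U" "Re s > 0"
  shows "lift_end (path_class U (linepath 1 s)) = s"
proof -
  have "path_image (linepath 1 s) \<subseteq> U"
    using closed_segment_subset[of 1 "{s. Re s > 0}" s] assms convex_halfspace_Re_gt[of 0] by auto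
  then show ?thesis by simp
qed

text \<open>\<open>L m\<close> continues \<open>Li_m (exp (c * s))\<close>. \<open>L 0\<close> is
  given explicitly because it alone has poles at the punctures; the functions
  \<open>L (Suc n)\<close> have only logarithms there, hence their order 0.\<close>

lemma polylog_continuation:
  fixes c :: real
  assumes c: "c < 0"
  defines "U \<equiv> - {s. exp (of_real c * s) = (1::complex)}"
  shows "\<exists>L. L 0 = (\<lambda>C. phi (of_real c) (lift_end C)) \<and>
    (\<forall>m. holomorphic_on_cover U 1 (L m)) \<and>
    (\<forall>m s. Re s > 0 \<longrightarrow> L m (path_class U (linepath 1 s)) = polylog m (exp (of_real c * s))) \<and>
    (\<forall>n z. exp (of_real c * z) = 1 \<longrightarrow>
      sheet_expansion U 1 (L (Suc n)) z (2 * pi / \<bar>c\<bar>) 0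
        (\<lambda>s. jonquiere_log (Suc n) (of_real c * (s - z))))"
proof -
  let ?c = "complex_of_real c" and ?H = "{s. Re s > 0}"
  have U: "open U" unfolding U_def by (rule open_exp_ne_1)
  have H: "open ?H" "convex ?H" by (auto simp: open_halfspace_Re_gt convex_halfspace_Re_gt)
  have lt1: "norm (exp (?c * s)) < 1" if "s \<in> ?H" for s
    using that c by (simp add: mult_neg_pos)
  have HU: "?H \<subseteq> U"
  proof
    fix s assume "s \<in> ?H"
    then show "s \<in> U" using lt1[of s] unfolding U_def by (auto simp del: norm_exp_eq_Re)
  qed
  have c0: "?c \<noteq> 0" using c by simp
  have hol: "(\<lambda>s. s ^ k * phi ?c s) holomorphic_on U" for k
    unfolding U_def by (intro holomorphic_intros holomorphic_phi)
  define P where "P k = lift_int (\<lambda>s. s ^ k * phi ?c s)" for k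
  have "((\<lambda>s. P k (path_class U (linepath 1 s))) has_field_derivative s ^ k * phi ?c s) (at s)"
    if "s \<in> ?H" for k s
    unfolding P_def using lift_int_linepath_has_field_derivative[OF U hol H HU _ that] by simp
  from polylog_exp_eq_primitives[OF H lt1, of "\<lambda>k s. P k (path_class U (linepath 1 s))", OF _ this]
  obtain B where B: "\<And>n. B n holomorphic_on UNIV"
    and B_eq: "\<And>n s. Re s > 0 \<Longrightarrow> polylog (Suc n) (exp (?c * s)) =
        B n s + (\<Sum>k\<le>n. kernel_coeff ?c n k s * P k (path_class U (linepath 1 s)))"
    by (metis mem_Collect_eq)
  define L where "L m C = (case m of 0 \<Rightarrow> phi ?c (lift_end C)
    | Suc n \<Rightarrow> B n (lift_end C) + (\<Sum>k\<le>n. kernel_coeff ?c n k (lift_end C) * P k C))" for m C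
  have "holomorphic_on_cover U 1 (L m)" for m
  proof (cases m)
    case 0
    then show ?thesis unfolding L_def U_def
      by (simp add: holomorphic_on_cover_lift_end[OF holomorphic_phi])
  next
    case (Suc n)
    have "B n holomorphic_on U" using B holomorphic_on_subset by blast
    then show ?thesis unfolding L_def Suc nat.case P_def
      by (intro holomorphic_on_cover_add holomorphic_on_cover_sum holomorphic_on_cover_mult
          holomorphic_on_cover_lift_int holomorphic_on_cover_lift_end U hol holomorphic_kernel_coeff)
  qed
  moreover have "L m (path_class U (linepath 1 s)) = polylog m (exp (?c * s))" if s: "Re s > 0" for m s
  proof -
    show ?thesis
      using lift_end_halfplane[OF HU s] B_eq[OF s] polylog_0[OF lt1, of s] s by (cases m) (auto simp: L_def phi_def)
  qed
  moreover have "sheet_expansion U 1 (L (Suc n)) z (2 * pi / \<bar>c\<bar>) 0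
        (\<lambda>s. jonquiere_log (Suc n) (?c * (s - z)))" if z: "exp (?c * z) = 1" for n z
  proof -
    let ?e = "2 * pi / \<bar>c\<bar>"
    have e: "?e = 2 * pi / norm ?c" by simp
    have sub: "ball z ?e - {z} \<subseteq> U"
      using exp_ne_1_punctured_ball[OF z c0] unfolding U_def e by blast
    have "sheet_expansion U 1 (P k) z ?e 0 (\<lambda>s. (z ^ k * phi_num ?c z z) * Ln (s - z))" for k
      unfolding P_def
    proof (rule sheet_expansion_lift_int[OF U hol sub, where K = "\<lambda>s. s ^ k * phi_num ?c z s"])
      show "(\<lambda>s. s ^ k * phi_num ?c z s) holomorphic_on ball z ?e"
        unfolding e by (intro holomorphic_intros holomorphic_phi_num c0)
    qed (simp add: phi_eq_phi_num[OF z])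
    then have "sheet_expansion U 1 (L (Suc n)) z ?e 0 (\<lambda>s. 0 +
        (\<Sum>k\<le>n. kernel_coeff ?c n k s * ((z ^ k * phi_num ?c z z) * Ln (s - z))))"
      unfolding L_def nat.case
      by (intro sheet_expansion_add sheet_expansion_sum sheet_expansion_mult_lift_end
          holomorphic_kernel_coeff sub sheet_expansion_lift_end[where K = "B n"]
          holomorphic_on_subset[OF B]) auto
    then show ?thesis
    proof (rule sheet_expansion_cong)
      show "(\<lambda>s. (?c * (s - z)) ^ n / fact n * of_real (ln (- c))) holomorphic_on ball z ?e"
        by (intro holomorphic_intros) auto
      fix s assume "s \<in> slit_ball z ?e"
      then have w: "s - z \<notin> \<real>\<^sub>\<le>\<^sub>0" by (simp add: slit_ball_def)
      \<comment> \<open>All logarithms carry the same residue up to the weight \<open>z ^ k\<close>,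
        so the binomial sum closes up to the kernel at \<open>t = z\<close>, and the residue
        \<open>- 1 / c\<close> cancels one power of \<open>c\<close>.\<close>
      have "(\<Sum>k\<le>n. kernel_coeff ?c n k s * ((z ^ k * phi_num ?c z z) * Ln (s - z))) =
          (\<Sum>k\<le>n. kernel_coeff ?c n k s * z ^ k) * (phi_num ?c z z * Ln (s - z))"
        unfolding sum_distrib_right by (intro sum.cong) (auto simp: mult_ac)
      also have "\<dots> = - ((?c * (s - z)) ^ n / fact n * Ln (s - z))"
        unfolding sum_kernel_coeff phi_num_pole[OF z] using c0 by (simp add: power_mult_distrib)
      finally show "0 + (\<Sum>k\<le>n. kernel_coeff ?c n k s * ((z ^ k * phi_num ?c z z) * Ln (s - z))) =
          (?c * (s - z)) ^ n / fact n * of_real (ln (- c)) + jonquiere_log (Suc n) (?c * (s - z))"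
        unfolding jonquiere_log_Suc_scaled[OF c w] by simp
    qed
  qed
  moreover have "L 0 = (\<lambda>C. phi ?c (lift_end C))" by (simp add: L_def fun_eq_iff)
  ultimately show ?thesis by blast
qed

subsection \<open>The zeta function and its remainder\<close>

lemma rr_bounds: "\<tau> > 0 \<Longrightarrow> 0 < rr \<tau>" "\<tau> > 0 \<Longrightarrow> rr \<tau> < 1" "\<tau> > 0 \<Longrightarrow> ln (rr \<tau>) < 0"
proof -
  show "0 < rr \<tau>" if "\<tau> > 0" for \<tau> using that by (simp add: rr_def)
  have half: "(1 - e) / 2 < 1" if "e > 0" for e :: real using that by simp
  show "rr \<tau> < 1" for \<tau> unfolding rr_def by (rule half) simp
  then show "ln (rr \<tau>) < 0" if "\<tau> > 0" for \<tau>
    using that \<open>\<And>\<tau>. \<tau> > 0 \<Longrightarrow> 0 < rr \<tau>\<close> by (simp add: ln_less_zero)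
qed

lemma C0_pos: "\<tau> > 0 \<Longrightarrow> C0 \<tau> > 0"
  by (simp add: C0_def)

lemma qq_eq: "\<tau> > 0 \<Longrightarrow> qq \<tau> s = exp (of_real (2 * ln (rr \<tau>)) * s)"
  using rr_bounds[of \<tau>] by (simp add: qq_def powr_def Ln_of_real mult_ac)

lemma C0_pow_eq: "\<tau> > 0 \<Longrightarrow> C0_pow \<tau> s = exp (of_real (ln (C0 \<tau>)) * s)"
  using C0_pos[of \<tau>] by (simp add: C0_pow_def powr_def Ln_of_real mult_ac)

lemma norm_qq: "\<tau> > 0 \<Longrightarrow> norm (qq \<tau> s) = exp (2 * ln (rr \<tau>) * Re s)"
  by (simp add: qq_eq)

lemma norm_qq_less_1: "\<tau> > 0 \<Longrightarrow> Re s > 0 \<Longrightarrow> norm (qq \<tau> s) < 1"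
  using rr_bounds(3)[of \<tau>] by (simp add: norm_qq mult_neg_pos)

lemma holomorphic_qq: "\<tau> > 0 \<Longrightarrow> qq \<tau> holomorphic_on S"
  by (subst holomorphic_cong[OF refl qq_eq]) (auto intro!: holomorphic_intros)

lemma holomorphic_C0_pow: "\<tau> > 0 \<Longrightarrow> C0_pow \<tau> holomorphic_on S"
  by (subst holomorphic_cong[OF refl C0_pow_eq]) (auto intro!: holomorphic_intros)

section \<open>Geometric decay of the overlaps\<close>

lemma sl_0: "sl 0 \<tau> = 1"
  by (simp add: sl_def w_poly_def u_poly_def sym_hat_def sym_norm_def sym_inner_def cst_def
      lookup_one lookup_single zero_prod_def[symmetric])

lemma sl_bounds:
  assumes a: "expansion_coeffs a" and \<tau>: "\<tau> > 0"
  shows "\<forall>\<^sub>F l in sequentially. 0 < sl l \<tau> \<and> sl l \<tau> \<le> 2 * C0 \<tau> * rr \<tau> ^ (2 * l)"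
proof -
  \<comment> \<open>The expansion at order 0: the sum over \<open>j\<close> is empty and
    \<open>E\<close> tends to 0. Once \<open>E\<close> is below 1/2 in absolute value,
    \<open>sl\<close> is positive, so that \<open>ln (sl l \<tau>)\<close> is a genuine
    logarithm.\<close>
  obtain E where E: "E \<in> O(\<lambda>l. 1 / real l ^ (0 + 1))"
    and sl: "\<And>l. l \<ge> 1 \<Longrightarrow> sl l \<tau> = C0 \<tau> * rr \<tau> ^ (2 * l) * (1 + (\<Sum>j=1..0. a j \<tau> / real l ^ j) + E l)"
    using a \<tau> unfolding expansion_coeffs_def by blast
  obtain k where "\<forall>\<^sub>F l in sequentially. norm (E l) \<le> k * norm (1 / real l ^ (0 + 1))"
    using landau_o.bigE[OF E] by blast
  moreover have "(\<lambda>l. k * norm (1 / real l ^ (0 + 1))) \<longlonglongrightarrow> 0"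
    using tendsto_mult_right_zero[OF lim_1_over_n, of k] by simp
  ultimately have "E \<longlonglongrightarrow> 0" by (rule Lim_null_comparison)
  then have "\<forall>\<^sub>F l in sequentially. \<bar>E l\<bar> < 1 / 2"
    using tendstoD[of E 0 sequentially "1 / 2"] by simp
  then show ?thesis using eventually_ge_at_top[of 1]
  proof eventually_elim
    case (elim l)
    have p: "C0 \<tau> * rr \<tau> ^ (2 * l) > 0" using C0_pos rr_bounds \<tau> by simp
    have "0 < 1 + E l" "1 + E l \<le> 2" using elim by auto
    then have "0 < C0 \<tau> * rr \<tau> ^ (2 * l) * (1 + E l)"
      "C0 \<tau> * rr \<tau> ^ (2 * l) * (1 + E l) \<le> C0 \<tau> * rr \<tau> ^ (2 * l) * 2"
      using p by (auto intro!: mult_pos_pos mult_left_mono)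
    then show ?case using sl[of l] elim by (simp add: mult_ac)
  qed
qed

text \<open>As \<open>ln (rr \<tau>) < 0\<close>, the slowest decay on \<open>K\<close> occurs at
  the smallest real part, which is attained and positive by compactness; it determines the common
  ratio.\<close>

lemma geometric_bounds:
  assumes a: "expansion_coeffs a" and \<tau>: "\<tau> > 0" and K: "compact K" "K \<subseteq> {s. Re s > 0}"
  obtains D \<rho> where "0 < \<rho>" "\<rho> < 1" "\<And>l s. s \<in> K \<Longrightarrow> norm (qq \<tau> s ^ l) \<le> \<rho> ^ l"
    "\<forall>\<^sub>F l in sequentially. \<forall>s\<in>K. norm (sl_pow l \<tau> s) \<le> D * \<rho> ^ l"
proof (cases "K = {}")
  case True
  then show ?thesis using that[of "1/2"] by simp
next
  case False
  obtain s0 where s0: "s0 \<in> K" "\<And>s. s \<in> K \<Longrightarrow> Re s0 \<le> Re s"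
    using continuous_attains_inf[OF K(1) False continuous_on_Re[OF continuous_on_id]] by auto
  obtain s1 where s1: "\<And>s. s \<in> K \<Longrightarrow> Re s \<le> Re s1"
    using continuous_attains_sup[OF K(1) False continuous_on_Re[OF continuous_on_id]] by auto
  define \<rho> where "\<rho> = exp (2 * ln (rr \<tau>) * Re s0)"
  \<comment> \<open>\<open>ln (2 * C0 \<tau>)\<close> may have either sign, so the bound at the
    largest real part is taken with its absolute value.\<close>
  define D where "D = exp (Re s1 * \<bar>ln (2 * C0 \<tau>)\<bar>)"
  have L: "ln (rr \<tau>) < 0" using rr_bounds \<tau> by blast
  have pos: "Re s > 0" if "s \<in> K" for s using that K by blast
  have \<rho>: "0 < \<rho>" "\<rho> < 1" using L pos[OF s0(1)] by (simp_all add: \<rho>_def mult_neg_pos)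
  have exp_le: "exp (2 * ln (rr \<tau>) * Re s) \<le> \<rho>" if "s \<in> K" for s
    using s0(2)[OF that] L by (simp add: \<rho>_def mult_left_mono_neg)
  have q: "norm (qq \<tau> s ^ l) \<le> \<rho> ^ l" if "s \<in> K" for s l
    using exp_le[OF that] \<tau> by (simp add: norm_power norm_qq power_mono)
  have "\<forall>\<^sub>F l in sequentially. \<forall>s\<in>K. norm (sl_pow l \<tau> s) \<le> D * \<rho> ^ l"
    using sl_bounds[OF a \<tau>]
  proof eventually_elim
    case (elim l)
    have C: "C0 \<tau> > 0" "rr \<tau> > 0" using C0_pos rr_bounds \<tau> by auto
    have "ln (sl l \<tau>) \<le> ln (2 * C0 \<tau> * rr \<tau> ^ (2 * l))" using elim by simp
    also have "\<dots> = ln (2 * C0 \<tau>) + real l * (2 * ln (rr \<tau>))"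
      using C by (simp add: ln_mult ln_realpow)
    finally have ln: "ln (sl l \<tau>) \<le> ln (2 * C0 \<tau>) + real l * (2 * ln (rr \<tau>))" .
    show ?case
    proof
      fix s assume s: "s \<in> K"
      have "norm (sl_pow l \<tau> s) = exp (Re s * ln (sl l \<tau>))" by (simp add: sl_pow_def)
      also have "\<dots> \<le> exp (Re s * (ln (2 * C0 \<tau>) + real l * (2 * ln (rr \<tau>))))"
        using ln pos[OF s] by simp
      also have "\<dots> = exp (Re s * ln (2 * C0 \<tau>)) * exp (2 * ln (rr \<tau>) * Re s) ^ l"
        by (simp add: exp_add[symmetric] exp_of_nat_mult[symmetric] algebra_simps)
      also have "\<dots> \<le> D * \<rho> ^ l"
      proof (intro mult_mono power_mono exp_le[OF s])
        have "Re s * ln (2 * C0 \<tau>) \<le> Re s * \<bar>ln (2 * C0 \<tau>)\<bar>"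
          using pos[OF s] by (intro mult_left_mono) auto
        also have "\<dots> \<le> Re s1 * \<bar>ln (2 * C0 \<tau>)\<bar>" using s1[OF s] by (intro mult_right_mono) auto
        finally show "exp (Re s * ln (2 * C0 \<tau>)) \<le> D" by (simp add: D_def)
      qed (auto simp: D_def)
      finally show "norm (sl_pow l \<tau> s) \<le> D * \<rho> ^ l" .
    qed
  qed
  then show ?thesis using that[OF \<rho> q] by blast
qed

section \<open>Termwise summation of the expansion\<close>

lemma odd_geometric_sums:
  fixes z :: "'a::{real_normed_field,banach}"
  assumes "norm z < 1"
  shows "(\<lambda>l. of_nat (2 * l + 1) * z ^ l) sums ((1 + z) / (1 - z) ^ 2)"
proof -
  have z: "1 - z \<noteq> 0" using assms by auto
  \<comment> \<open>From \<open>2 * l + 1 = 2 * (l + 1) - 1\<close>: twice the differentiated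
    geometric series minus the geometric series.\<close>
  have "(\<lambda>l. 2 * (of_nat (Suc l) * z ^ l) - z ^ l) sums (2 * (1 / (1 - z)^2) - 1 / (1 - z))"
    by (intro sums_diff sums_mult geometric_deriv_sums geometric_sums assms)
  moreover have "2 * (1 / (1 - z)^2) - 1 / (1 - z) = (1 + z) / (1 - z) ^ 2"
  proof -
    have "1 / (1 - z) = (1 - z) / (1 - z) ^ 2" using z by (simp add: power2_eq_square)
    then show ?thesis by (simp add: diff_divide_distrib[symmetric])
  qed
  ultimately show ?thesis by (simp add: algebra_simps)
qed

lemma summable_Z_T:
  assumes a: "expansion_coeffs a" and \<tau>: "\<tau> > 0" and s: "Re s > 0"
  shows "summable (\<lambda>l. norm (of_nat (2 * l + 1) * sl_pow l \<tau> s))"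
proof -
  obtain D \<rho> where \<rho>: "0 < \<rho>" "\<rho> < 1"
    and sl: "\<forall>\<^sub>F l in sequentially. \<forall>s\<in>{s}. norm (sl_pow l \<tau> s) \<le> D * \<rho> ^ l"
    by (rule geometric_bounds[OF a \<tau>, of "{s}"]) (use s in auto)
  have "summable (\<lambda>l. D * (of_nat (2 * l + 1) * \<rho> ^ l))"
    using odd_geometric_sums[of \<rho>] \<rho> by (intro summable_mult) (simp add: sums_iff)
  then show ?thesis
  proof (rule summable_comparison_test_ev[rotated])
    show "\<forall>\<^sub>F l in sequentially. norm (norm (of_nat (2 * l + 1) * sl_pow l \<tau> s)) \<le>
        D * (of_nat (2 * l + 1) * \<rho> ^ l)"
      using sl
    proof eventually_elim
      case (elim l)
      have "real (2 * l + 1) * norm (sl_pow l \<tau> s) \<le> real (2 * l + 1) * (D * \<rho> ^ l)"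
        using elim by (intro mult_left_mono) auto
      then have "norm (of_nat (2 * l + 1) * sl_pow l \<tau> s) \<le> D * (of_nat (2 * l + 1) * \<rho> ^ l)"
        by (simp only: norm_mult norm_of_nat mult_ac)
      then show ?case by (simp only: real_norm_def abs_norm_cancel)
    qed
  qed
qed

text \<open>The identity \<open>(2 * l + 1) / l ^ j = 2 / l ^ (j - 1) + 1 / l ^ j\<close> turns each
  correction into \<open>2 Li_(j-1) + Li_j\<close>. Since \<open>norm q < 1\<close>, each series
  converges on its own and the remainder series is their linear combination.\<close>

lemma remainder_term_sums:
  assumes a: "expansion_coeffs a" and \<tau>: "\<tau> > 0" and s: "Re s > 0"
  shows "(\<lambda>l. remainder_term p N \<tau> (Suc l) s) sums
    ((Z_T s \<tau> - 1) - C0_pow \<tau> s * ((1 + qq \<tau> s) / (1 - qq \<tau> s) ^ 2 - 1 +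
      (\<Sum>j=1..N. poly (p j \<tau>) s * (2 * polylog (j - 1) (qq \<tau> s) + polylog j (qq \<tau> s)))))"
proof -
  define q where "q = qq \<tau> s"
  have q: "norm q < 1" using norm_qq_less_1 \<tau> s by (simp add: q_def)
  have "(\<lambda>l. of_nat (2 * l + 1) * sl_pow l \<tau> s) sums Z_T s \<tau>"
    unfolding Z_T_def using summable_norm_cancel[OF summable_Z_T[OF a \<tau> s]] by (rule summable_sums)
  \<comment> \<open>The summand at \<open>l = 0\<close> is 1, both here and in the geometric series
    below. These two make up the separate summand \<open>1 - C0_pow \<tau> s\<close> of the
    remainder.\<close>
  then have Z: "(\<lambda>l. of_nat (2 * Suc l + 1) * sl_pow (Suc l) \<tau> s) sums (Z_T s \<tau> - 1)"
    by (subst sums_Suc_iff) (simp add: sl_pow_def sl_0)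
  have geo: "(\<lambda>l. of_nat (2 * Suc l + 1) * q ^ Suc l) sums ((1 + q) / (1 - q) ^ 2 - 1)"
    using odd_geometric_sums[OF q] by (subst sums_Suc_iff) simp
  have li: "(\<lambda>l. q ^ Suc l / of_nat (Suc l) ^ m) sums polylog m q" for m
    unfolding polylog_def using summable_polylog[OF q] by (rule summable_sums)
  have "(\<lambda>l. of_nat (2 * Suc l + 1) * sl_pow (Suc l) \<tau> s - C0_pow \<tau> s *
      (of_nat (2 * Suc l + 1) * q ^ Suc l +
       (\<Sum>j=1..N. poly (p j \<tau>) s * (2 * (q ^ Suc l / of_nat (Suc l) ^ (j - 1)) + q ^ Suc l / of_nat (Suc l) ^ j))))
    sums ((Z_T s \<tau> - 1) - C0_pow \<tau> s * ((1 + q) / (1 - q) ^ 2 - 1 +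
      (\<Sum>j=1..N. poly (p j \<tau>) s * (2 * polylog (j - 1) q + polylog j q))))"
    by (intro sums_diff sums_mult sums_add sums_sum Z geo li)
  moreover have "of_nat (2 * Suc l + 1) * sl_pow (Suc l) \<tau> s - C0_pow \<tau> s *
      (of_nat (2 * Suc l + 1) * q ^ Suc l +
       (\<Sum>j=1..N. poly (p j \<tau>) s * (2 * (q ^ Suc l / of_nat (Suc l) ^ (j - 1)) + q ^ Suc l / of_nat (Suc l) ^ j)))
      = remainder_term p N \<tau> (Suc l) s" for l
  proof -
    define n :: complex where "n = of_nat (Suc l)"
    have n: "n \<noteq> 0" unfolding n_def by (simp del: of_nat_Suc)
    have "(\<Sum>j=1..N. poly (p j \<tau>) s * (2 * (q ^ Suc l / n ^ (j - 1)) + q ^ Suc l / n ^ j)) =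
        (\<Sum>j=1..N. (2 * n + 1) * q ^ Suc l * (poly (p j \<tau>) s / n ^ j))"
    proof (intro sum.cong refl)
      fix j assume "j \<in> {1..N}"
      then obtain i where "j = Suc i" by (cases j) auto
      then show "poly (p j \<tau>) s * (2 * (q ^ Suc l / n ^ (j - 1)) + q ^ Suc l / n ^ j) =
          (2 * n + 1) * q ^ Suc l * (poly (p j \<tau>) s / n ^ j)"
        using n by (simp add: field_simps)
    qed
    also have "\<dots> = (2 * n + 1) * q ^ Suc l * (\<Sum>j=1..N. poly (p j \<tau>) s / n ^ j)"
      by (simp only: sum_distrib_left)
    finally have *: "(\<Sum>j=1..N. poly (p j \<tau>) s * (2 * (q ^ Suc l / n ^ (j - 1)) + q ^ Suc l / n ^ j)) =
        (2 * n + 1) * q ^ Suc l * (\<Sum>j=1..N. poly (p j \<tau>) s / n ^ j)" .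
    have n': "of_nat (2 * Suc l + 1) = 2 * n + 1" by (simp add: n_def)
    show ?thesis unfolding remainder_term_def n' n_def[symmetric] * q_def[symmetric]
      by (simp add: algebra_simps)
  qed
  ultimately show ?thesis unfolding q_def by simp
qed

lemma Z_T_eq:
  assumes a: "expansion_coeffs a" and \<tau>: "\<tau> > 0" and s: "Re s > 0"
  shows "Z_T s \<tau> = C0_pow \<tau> s * ((1 + qq \<tau> s) / (1 - qq \<tau> s) ^ 2)
     + C0_pow \<tau> s * (\<Sum>j=1..N. poly (p j \<tau>) s *
        (2 * polylog (j - 1) (qq \<tau> s) + polylog j (qq \<tau> s)))
     + remainder p N \<tau> s"
  unfolding remainder_def sums_unique[OF remainder_term_sums[OF assms], symmetric]
  by (simp add: algebra_simps)

text \<open>The power of \<open>sl\<close> and its approximation each decay like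
  \<open>\<rho> ^ l\<close> uniformly on \<open>K\<close>, which outweighs the factor
  \<open>2 * l + 1\<close>; the triangle inequality then provides the majorant of the
  M-test.\<close>

lemma remainder_partial_sums_uniform:
  assumes a: "expansion_coeffs a" and \<tau>: "\<tau> > 0" and K: "compact K" "K \<subseteq> {s. Re s > 0}"
  shows "uniform_limit K (\<lambda>M s. (1 - C0_pow \<tau> s) + (\<Sum>l=1..M. remainder_term p N \<tau> l s))
    (remainder p N \<tau>) sequentially"
proof -
  obtain D \<rho> where \<rho>: "0 < \<rho>" "\<rho> < 1" and q: "\<And>l s. s \<in> K \<Longrightarrow> norm (qq \<tau> s ^ l) \<le> \<rho> ^ l"
    and sl: "\<forall>\<^sub>F l in sequentially. \<forall>s\<in>K. norm (sl_pow l \<tau> s) \<le> D * \<rho> ^ l"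
    by (rule geometric_bounds[OF a \<tau> K]) blast
  \<comment> \<open>Dividing by \<open>l ^ j\<close> with \<open>l >= 1\<close> only shrinks a
    summand, so \<open>G\<close> bounds the factor in front of \<open>q ^ l\<close> for all such
    \<open>l\<close> at once.\<close>
  define G where "G s = norm (C0_pow \<tau> s) * (1 + (\<Sum>j=1..N. norm (poly (p j \<tau>) s)))" for s
  have "continuous_on K G"
    unfolding G_def using holomorphic_on_imp_continuous_on[OF holomorphic_C0_pow[OF \<tau>]]
    by (intro continuous_intros) auto
  then have "bounded (G ` K)" using K(1) compact_continuous_image compact_imp_bounded by blast
  then obtain B where B: "\<And>s. s \<in> K \<Longrightarrow> G s \<le> B"
    unfolding bounded_iff by (force simp: abs_le_iff)
  have sm: "summable (\<lambda>l. (D + B) * (of_nat (2 * Suc l + 1) * \<rho> ^ Suc l))"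
  proof (rule summable_mult)
    have "summable (\<lambda>l. of_nat (2 * l + 1) * \<rho> ^ l)"
      using odd_geometric_sums[of \<rho>] \<rho> by (simp add: sums_iff)
    then show "summable (\<lambda>l. of_nat (2 * Suc l + 1) * \<rho> ^ Suc l)" by (subst summable_Suc_iff)
  qed
  have ev: "\<forall>\<^sub>F l in sequentially. \<forall>s\<in>K. norm (remainder_term p N \<tau> (Suc l) s) \<le>
      (D + B) * (of_nat (2 * Suc l + 1) * \<rho> ^ Suc l)"
    using sl[THEN eventually_sequentially_Suc[THEN iffD2]]
  proof eventually_elim
    case (elim l)
    show ?case
    proof
      fix s assume s: "s \<in> K"
      let ?S = "\<Sum>j=1..N. poly (p j \<tau>) s / of_nat (Suc l) ^ j"
      have "norm ?S \<le> (\<Sum>j=1..N. norm (poly (p j \<tau>) s))"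
      proof (intro sum_norm_le)
        fix j
        show "norm (poly (p j \<tau>) s / of_nat (Suc l) ^ j) \<le> norm (poly (p j \<tau>) s)"
          using divide_left_mono[of 1 "real (Suc l) ^ j" "norm (poly (p j \<tau>) s)"]
            one_le_power[of "real (Suc l)" j]
          by (simp add: norm_divide norm_power del: of_nat_Suc)
      qed
      then have "norm (1 + ?S) \<le> 1 + (\<Sum>j=1..N. norm (poly (p j \<tau>) s))"
        using norm_triangle_ineq[of 1 ?S] by simp
      then have "norm (C0_pow \<tau> s) * norm (1 + ?S) \<le> G s"
        unfolding G_def by (rule mult_left_mono) simp
      then have CB: "norm (C0_pow \<tau> s) * norm (1 + ?S) \<le> B" using B[OF s] by linarith
      \<comment> \<open>Read off at a point of \<open>K\<close>: for empty \<open>K\<close> the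
        bound \<open>B\<close> could have any sign.\<close>
      then have "0 \<le> B"
        using mult_nonneg_nonneg[OF norm_ge_zero[of "C0_pow \<tau> s"] norm_ge_zero[of "1 + ?S"]] by linarith
      moreover have "norm (qq \<tau> s ^ Suc l) \<le> \<rho> ^ Suc l" using q[OF s] .
      ultimately have "norm (C0_pow \<tau> s) * norm (1 + ?S) * norm (qq \<tau> s ^ Suc l) \<le> B * \<rho> ^ Suc l"
        by (intro mult_mono CB norm_ge_zero)
      moreover have "norm (sl_pow (Suc l) \<tau> s) \<le> D * \<rho> ^ Suc l" using elim s by blast
      moreover have "norm (sl_pow (Suc l) \<tau> s - C0_pow \<tau> s * qq \<tau> s ^ Suc l * (1 + ?S)) \<le>
          norm (sl_pow (Suc l) \<tau> s) + norm (C0_pow \<tau> s) * norm (1 + ?S) * norm (qq \<tau> s ^ Suc l)"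
        using norm_triangle_ineq4[of "sl_pow (Suc l) \<tau> s" "C0_pow \<tau> s * qq \<tau> s ^ Suc l * (1 + ?S)"]
        unfolding norm_mult by (simp only: mult_ac)
      ultimately have "norm (sl_pow (Suc l) \<tau> s - C0_pow \<tau> s * qq \<tau> s ^ Suc l * (1 + ?S)) \<le>
          (D + B) * \<rho> ^ Suc l" unfolding distrib_right by linarith
      then have "real (2 * Suc l + 1) * norm (sl_pow (Suc l) \<tau> s - C0_pow \<tau> s * qq \<tau> s ^ Suc l * (1 + ?S)) \<le>
          real (2 * Suc l + 1) * ((D + B) * \<rho> ^ Suc l)" by (rule mult_left_mono) simp
      then show "norm (remainder_term p N \<tau> (Suc l) s) \<le>
          (D + B) * (of_nat (2 * Suc l + 1) * \<rho> ^ Suc l)"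
        unfolding remainder_term_def norm_mult norm_of_nat by (simp only: mult_ac)
    qed
  qed
  have "uniform_limit K (\<lambda>M s. \<Sum>l<M. remainder_term p N \<tau> (Suc l) s)
      (\<lambda>s. suminf (\<lambda>l. remainder_term p N \<tau> (Suc l) s)) sequentially"
    using ev sm by (rule Weierstrass_m_test_ev)
  then have "uniform_limit K
      (\<lambda>M s. (1 - C0_pow \<tau> s) + (\<Sum>l<M. remainder_term p N \<tau> (Suc l) s))
      (\<lambda>s. (1 - C0_pow \<tau> s) + suminf (\<lambda>l. remainder_term p N \<tau> (Suc l) s)) sequentially"
    by (intro uniform_limit_add uniform_limit_const)
  moreover have "(\<Sum>l<M. remainder_term p N \<tau> (Suc l) s) = (\<Sum>l=1..M. remainder_term p N \<tau> l s)" for M s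
    by (rule sum.reindex_bij_witness[of _ "\<lambda>l. l - 1" Suc]) auto
  ultimately show ?thesis unfolding remainder_def[abs_def] by (simp only:)
qed

lemma holomorphic_remainder_term: "\<tau> > 0 \<Longrightarrow> remainder_term p N \<tau> l holomorphic_on S"
  unfolding remainder_term_def[abs_def] sl_pow_def divide_inverse
  by (intro holomorphic_intros holomorphic_qq holomorphic_C0_pow) auto

lemma
  assumes a: "expansion_coeffs a" and \<tau>: "\<tau> > 0"
  shows holomorphic_remainder: "remainder p N \<tau> holomorphic_on {s. Re s > 0}"
    and uniform_limit_deriv_remainder: "compact K \<Longrightarrow> K \<subseteq> {s. Re s > 0} \<Longrightarrow>
      uniform_limit K
        (\<lambda>M s. (deriv ^^ n) (\<lambda>s. 1 - C0_pow \<tau> s) s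
               + (\<Sum>l=1..M. (deriv ^^ n) (remainder_term p N \<tau> l) s))
        ((deriv ^^ n) (remainder p N \<tau>)) sequentially"
proof -
  let ?H = "{s. Re s > 0}"
  let ?f = "\<lambda>M s. (1 - C0_pow \<tau> s) + (\<Sum>l=1..M. remainder_term p N \<tau> l s)"
  have H: "open ?H" by (simp add: open_halfspace_Re_gt)
  have h0: "(\<lambda>s. 1 - C0_pow \<tau> s) holomorphic_on ?H"
    using \<tau> by (intro holomorphic_intros holomorphic_C0_pow)
  have hs: "(\<lambda>s. \<Sum>l=1..M. remainder_term p N \<tau> l s) holomorphic_on ?H" for M
    using \<tau> by (intro holomorphic_intros holomorphic_remainder_term)
  have hol: "?f M holomorphic_on ?H" for M using h0 hs by (intro holomorphic_on_add)
  note lim = remainder_partial_sums_uniform[OF a \<tau>, of _ p N]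
  show "remainder p N \<tau> holomorphic_on ?H"
    using holomorphic_compact_limit[OF H hol lim] .
  assume K: "compact K" "K \<subseteq> ?H"
  have sum: "(deriv ^^ n) (\<lambda>s. \<Sum>l\<in>I. remainder_term p N \<tau> l s) z =
      (\<Sum>l\<in>I. (deriv ^^ n) (remainder_term p N \<tau> l) z)" if "finite I" for I z
    using that
  proof induction
    case empty
    then show ?case by (simp add: higher_deriv_const)
  next
    case (insert l I)
    have "(deriv ^^ n) (\<lambda>s. remainder_term p N \<tau> l s + (\<Sum>l\<in>I. remainder_term p N \<tau> l s)) z =
        (deriv ^^ n) (remainder_term p N \<tau> l) z + (deriv ^^ n) (\<lambda>s. \<Sum>l\<in>I. remainder_term p N \<tau> l s) z"
      using \<tau> by (intro higher_deriv_add[of _ UNIV]) (auto intro!: holomorphic_intros holomorphic_remainder_term)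
    then show ?case using insert by simp
  qed
  have "(deriv ^^ n) (?f M) z = (deriv ^^ n) (\<lambda>s. 1 - C0_pow \<tau> s) z
      + (\<Sum>l=1..M. (deriv ^^ n) (remainder_term p N \<tau> l) z)" if "z \<in> K" for M z
    using higher_deriv_add[OF h0 hs H, of z n M] K that by (auto simp: sum)
  then show "uniform_limit K
        (\<lambda>M s. (deriv ^^ n) (\<lambda>s. 1 - C0_pow \<tau> s) s
               + (\<Sum>l=1..M. (deriv ^^ n) (remainder_term p N \<tau> l) s))
        ((deriv ^^ n) (remainder p N \<tau>)) sequentially"
    using uniform_limit_higher_deriv[OF H hol lim K, of n]
    by (subst uniform_limit_cong'[where g = "\<lambda>M. (deriv ^^ n) (?f M)"]) auto
qed

subsection \<open>The double pole of the first term\<close>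

lemma PP_eq: "\<tau> > 0 \<Longrightarrow> PP \<tau> = {s. exp (of_real (2 * ln (rr \<tau>)) * s) = 1}"
  by (simp add: PP_def qq_eq)

lemma PP_eq_lattice:
  assumes \<tau>: "\<tau> > 0"
  shows "PP \<tau> = {of_real pi * \<i> * of_int k / of_real (ln (rr \<tau>)) | k :: int. True}"
proof -
  define x where "x = ln (rr \<tau>)"
  have x: "x \<noteq> 0" using rr_bounds(3)[OF \<tau>] by (simp add: x_def)
  have "exp (of_real (2 * x) * s) = 1 \<longleftrightarrow> (\<exists>k::int. s = of_real pi * \<i> * of_int k / of_real x)" for s
  proof -
    have "exp (of_real (2 * x) * s) = 1 \<longleftrightarrow> (\<exists>k::int. 2 * x * Re s = 0 \<and> 2 * x * Im s = of_int (2 * k) * pi)"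
      by (simp add: exp_eq_1)
    also have "\<dots> \<longleftrightarrow> (\<exists>k::int. s = of_real pi * \<i> * of_int k / of_real x)"
      using x by (intro ex_cong1) (auto simp: complex_eq_iff field_simps)
    finally show ?thesis .
  qed
  then show ?thesis unfolding PP_eq[OF \<tau>] x_def[symmetric] by auto
qed

text \<open>The numerator over the double pole at a puncture \<open>z\<close>. It comes from
  \<open>1 - q = - c * (s - z) * exp_quot (c * (s - z))\<close> with
  \<open>c = 2 * ln (rr \<tau>)\<close>; the sign disappears on squaring.\<close>

definition first_num :: "real \<Rightarrow> complex \<Rightarrow> complex \<Rightarrow> complex" where
  "first_num \<tau> z s = C0_pow \<tau> s * (1 + qq \<tau> s) /
    (of_real (2 * ln (rr \<tau>)) * exp_quot (of_real (2 * ln (rr \<tau>)) * (s - z))) ^ 2"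

lemma holomorphic_first_num:
  assumes \<tau>: "\<tau> > 0"
  shows "first_num \<tau> z holomorphic_on ball z (2 * pi / \<bar>2 * ln (rr \<tau>)\<bar>)"
proof -
  let ?c = "complex_of_real (2 * ln (rr \<tau>))"
  have c: "?c \<noteq> 0" using rr_bounds(3)[OF \<tau>] by simp
  have "exp_quot (?c * (s - z)) \<noteq> 0" if "s \<in> ball z (2 * pi / \<bar>2 * ln (rr \<tau>)\<bar>)" for s
    using exp_quot_nonzero_ball[OF c, of s z] that unfolding norm_of_real by blast
  then show ?thesis unfolding first_num_def[abs_def]
    using c by (intro holomorphic_intros holomorphic_C0_pow holomorphic_qq \<tau>) auto
qed

text \<open>The equation holds at \<open>s = z\<close> too, where division by zero makes both sides
  0. It is thus an equality of functions, which can be rewritten under \<open>is_pole\<close> and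
  \<open>zorder\<close>.\<close>

lemma first_term_eq_first_num:
  assumes \<tau>: "\<tau> > 0" and z: "z \<in> PP \<tau>"
  shows "first_term \<tau> s = first_num \<tau> z s / (s - z) ^ 2"
proof -
  have "exp (of_real (2 * ln (rr \<tau>)) * z) = 1" using z PP_eq[OF \<tau>] by blast
  from one_minus_exp_eq_exp_quot[OF this]
  show ?thesis unfolding first_term_def first_num_def qq_eq[OF \<tau>]
    by (simp only: power_mult_distrib power2_minus divide_divide_eq_left mult_minus_left
        times_divide_eq_right mult_ac)
qed

lemma first_num_pole:
  assumes \<tau>: "\<tau> > 0" and z: "z \<in> PP \<tau>"
  shows "first_num \<tau> z z = C0_pow \<tau> z / (2 * of_real (ln (rr \<tau>)) ^ 2)"
  using z by (simp add: first_num_def PP_def power_mult_distrib)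

text \<open>At a puncture \<open>q = 1\<close>, so the numerator there is a nonzero multiple of an
  exponential; no zero reduces the order 2.\<close>

lemma first_term_double_pole:
  assumes \<tau>: "\<tau> > 0" and z: "z \<in> PP \<tau>"
  shows "is_pole (first_term \<tau>) z" "zorder (first_term \<tau>) z = - 2"
proof -
  let ?e = "2 * pi / \<bar>2 * ln (rr \<tau>)\<bar>"
  have e: "?e > 0" using rr_bounds(3)[OF \<tau>] by (intro divide_pos_pos) auto
  have nz: "first_num \<tau> z z \<noteq> 0"
    unfolding first_num_pole[OF \<tau> z] C0_pow_eq[OF \<tau>] using rr_bounds(3)[OF \<tau>] by simp
  have eq: "first_term \<tau> = (\<lambda>s. first_num \<tau> z s / (s - z) ^ 2)"
    using first_term_eq_first_num[OF \<tau> z] by (rule ext)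
  show "is_pole (first_term \<tau>) z" unfolding eq
    by (rule is_pole_basic[OF holomorphic_first_num[OF \<tau>]]) (use e nz in auto)
  show "zorder (first_term \<tau>) z = - 2"
  proof (rule zorder_eqI[OF open_ball _ holomorphic_first_num[OF \<tau>] nz])
    show "z \<in> ball z ?e" using e by simp
    fix w
    show "first_term \<tau> w = first_num \<tau> z w * (w - z) powi - 2"
      by (simp add: eq power_int_def divide_inverse power_inverse)
  qed
qed

text \<open>Over a double pole the coefficient of \<open>1 / s\<close> is the first Taylor
  coefficient of the numerator. With \<open>x = ln r\<close> and \<open>y = ln C_0\<close>, the
  quotient rule uses the values 2 and \<open>4 * x ^ 2\<close> and the derivatives
  \<open>2 * y + 2 * x\<close> and \<open>8 * x ^ 3\<close> at 0.\<close>

lemma deriv_first_num_0: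
  assumes \<tau>: "\<tau> > 0"
  shows "deriv (first_num \<tau> 0) 0 = of_real ((ln (C0 \<tau>) - ln (rr \<tau>)) / (2 * (ln (rr \<tau>))\<^sup>2))"
proof -
  define x where "x = complex_of_real (ln (rr \<tau>))"
  define y where "y = complex_of_real (ln (C0 \<tau>))"
  have x: "x \<noteq> 0" using rr_bounds(3)[OF \<tau>] by (simp add: x_def)
  have eq: "first_num \<tau> 0 = (\<lambda>s. exp (y * s) * (1 + exp (2 * x * s)) / (2 * x * exp_quot (2 * x * s)) ^ 2)"
    by (rule ext) (simp add: first_num_def C0_pow_eq[OF \<tau>] qq_eq[OF \<tau>] x_def y_def)
  have e: "((\<lambda>s. exp_quot (2 * x * s)) has_field_derivative x) (at 0)"
  proof -
    have "((\<lambda>s. 2 * x * s) has_field_derivative 2 * x) (at 0)"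
      by (auto intro!: derivative_eq_intros)
    then show ?thesis
      using DERIV_chain2[of exp_quot "1 / 2" "\<lambda>s. 2 * x * s" 0 "2 * x" UNIV] deriv_exp_quot_0 by simp
  qed
  have n: "((\<lambda>s. exp (y * s) * (1 + exp (2 * x * s))) has_field_derivative 2 * y + 2 * x) (at 0)"
    by (auto intro!: derivative_eq_intros)
  have d: "((\<lambda>s. (2 * x * exp_quot (2 * x * s)) ^ 2) has_field_derivative 8 * x ^ 3) (at 0)"
    using DERIV_power[OF DERIV_cmult[OF e, of "2 * x"], of 2] by (simp add: power2_eq_square power3_eq_cube mult_ac)
  have "(first_num \<tau> 0 has_field_derivative
      ((2 * y + 2 * x) * (4 * x ^ 2) - 2 * (8 * x ^ 3)) / (4 * x ^ 2 * (4 * x ^ 2))) (at 0)"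
    unfolding eq using DERIV_divide[OF n d] x by (simp add: power_mult_distrib)
  moreover have "((2 * y + 2 * x) * (4 * x ^ 2) - 2 * (8 * x ^ 3)) / (4 * x ^ 2 * (4 * x ^ 2)) =
      (y - x) / (2 * x ^ 2)"
    using x by (simp add: field_simps power2_eq_square power3_eq_cube)
  ultimately have "(first_num \<tau> 0 has_field_derivative (y - x) / (2 * x ^ 2)) (at 0)" by simp
  then show ?thesis by (simp add: DERIV_imp_deriv x_def y_def)
qed

lemma first_term_laurent_0:
  assumes \<tau>: "\<tau> > 0"
  shows "(\<lambda>s. first_term \<tau> s
              - (of_real (1 / (2 * (ln (rr \<tau>))\<^sup>2)) * (1 / s\<^sup>2)
                 + of_real ((ln (C0 \<tau>) - ln (rr \<tau>)) / (2 * (ln (rr \<tau>))\<^sup>2)) * (1 / s)))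
          \<in> O[at 0](\<lambda>_. 1)"
proof -
  let ?e = "2 * pi / \<bar>2 * ln (rr \<tau>)\<bar>" and ?K = "first_num \<tau> 0"
  have e: "?e > 0" using rr_bounds(3)[OF \<tau>] by (intro divide_pos_pos) auto
  have z: "0 \<in> PP \<tau>" by (simp add: PP_eq[OF \<tau>])
  \<comment> \<open>Two successive difference quotients make \<open>D2\<close> the Taylor remainder
    of the numerator after two terms, divided by \<open>s ^ 2\<close>. This is the first term minus
    its polar part, and continuity at 0 bounds it.\<close>
  define D where "D = (\<lambda>s. if s = 0 then deriv ?K 0 else (?K s - ?K 0) / (s - 0))"
  define D2 where "D2 = (\<lambda>s. if s = 0 then deriv D 0 else (D s - D 0) / (s - 0))"
  have "D holomorphic_on ball 0 ?e"
    unfolding D_def by (rule pole_lemma_open[OF holomorphic_first_num[OF \<tau>] open_ball])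
  then have "D2 holomorphic_on ball 0 ?e"
    unfolding D2_def by (rule pole_lemma_open) simp
  then have "isCont D2 0"
    using e holomorphic_on_imp_continuous_on continuous_on_interior[of "ball 0 ?e" D2 0] by auto
  then have lim: "(D2 \<longlongrightarrow> D2 0) (at 0)" by (simp add: isCont_def)
  have "D2 \<in> O[at 0](\<lambda>_. 1)"
    by (rule bigoI_tendsto[of _ _ "D2 0"]) (use lim in auto)
  moreover have "\<forall>\<^sub>F s in at 0. D2 s = first_term \<tau> s
              - (of_real (1 / (2 * (ln (rr \<tau>))\<^sup>2)) * (1 / s\<^sup>2)
                 + of_real ((ln (C0 \<tau>) - ln (rr \<tau>)) / (2 * (ln (rr \<tau>))\<^sup>2)) * (1 / s))"
    unfolding eventually_at_filter
  proof (intro always_eventually allI impI)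
    fix s :: complex assume s: "s \<noteq> 0"
    have K0: "?K 0 = of_real (1 / (2 * (ln (rr \<tau>))\<^sup>2))"
      using first_num_pole[OF \<tau> z] by (simp add: C0_pow_eq[OF \<tau>])
    have "D2 s = ?K s / s\<^sup>2 - (?K 0 * (1 / s\<^sup>2) + D 0 * (1 / s))"
      using s by (simp add: D2_def D_def field_simps power2_eq_square)
    then show "D2 s = first_term \<tau> s
              - (of_real (1 / (2 * (ln (rr \<tau>))\<^sup>2)) * (1 / s\<^sup>2)
                 + of_real ((ln (C0 \<tau>) - ln (rr \<tau>)) / (2 * (ln (rr \<tau>))\<^sup>2)) * (1 / s))"
      unfolding K0 first_term_eq_first_num[OF \<tau> z] by (simp add: D_def deriv_first_num_0[OF \<tau>])
  qed
  ultimately show ?thesis by (rule landau_o.big.in_cong[THEN iffD1, rotated])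
qed

section \<open>Dependence of the polar coefficients on \<tau>\<close>

lemma polar_coeff_2_not_constant: "\<not> (\<lambda>\<tau>. 1 / (2 * (ln (rr \<tau>))\<^sup>2)) constant_on {0<..}"
proof
  assume "(\<lambda>\<tau>. 1 / (2 * (ln (rr \<tau>))\<^sup>2)) constant_on {0<..}"
  then obtain k where k: "\<And>\<tau>. \<tau> > 0 \<Longrightarrow> 1 / (2 * (ln (rr \<tau>))\<^sup>2) = k"
    by (auto simp: constant_on_def)
  have "1 / (2 * (ln (rr 1))\<^sup>2) = 1 / (2 * (ln (rr 2))\<^sup>2)" using k[of 1] k[of 2] by simp
  then have "(ln (rr 1))\<^sup>2 = (ln (rr 2))\<^sup>2" by simp
  \<comment> \<open>Both logarithms are negative, which rules out opposite signs.\<close>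
  then have "ln (rr 1) = ln (rr 2)"
    using rr_bounds(3)[of 1] rr_bounds(3)[of 2] by (auto simp: power2_eq_iff)
  then have "rr 1 = rr 2" using rr_bounds(1)[of 1] rr_bounds(1)[of 2] by simp
  then show False by (simp add: rr_def)
qed

text \<open>The limits at the two ends of the half-line differ. Towards 0 both logarithms diverge
  and the squared denominator wins, giving 0; at infinity \<open>C0\<close> tends to 1 and
  \<open>rr\<close> to 1/2, giving \<open>1 / (2 * ln 2)\<close>.\<close>

lemma polar_coeff_1_not_constant:
  "\<not> (\<lambda>\<tau>. (ln (C0 \<tau>) - ln (rr \<tau>)) / (2 * (ln (rr \<tau>))\<^sup>2)) constant_on {0<..}"
proof
  let ?f = "\<lambda>\<tau>. (ln (C0 \<tau>) - ln (rr \<tau>)) / (2 * (ln (rr \<tau>))\<^sup>2)"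
  assume "?f constant_on {0<..}"
  then obtain k where k: "\<And>\<tau>. \<tau> > 0 \<Longrightarrow> ?f \<tau> = k" by (auto simp: constant_on_def)
  have "(?f \<longlongrightarrow> 0) (at_right 0)" unfolding C0_def rr_def sinh_field_def by real_asymp
  moreover have "(?f \<longlongrightarrow> k) (at_right 0)"
    by (rule tendsto_eventually) (auto intro: eventually_mono[OF eventually_at_right_less[of 0]] k)
  ultimately have "k = 0" using tendsto_unique trivial_limit_at_right_real by blast
  have "(?f \<longlongrightarrow> 1 / (2 * ln 2)) at_top" unfolding C0_def rr_def sinh_field_def
    by real_asymp (simp add: ln_div power2_eq_square field_simps)
  moreover have "(?f \<longlongrightarrow> k) at_top"
    by (rule tendsto_eventually) (auto intro: eventually_mono[OF eventually_gt_at_top[of 0]] k)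
  ultimately have "k = 1 / (2 * ln 2)" using tendsto_unique trivial_limit_at_top_linorder by blast
  then show False using \<open>k = 0\<close> by simp
qed

subsection \<open>The displayed sum on the universal cover\<close>

lemma log_part_eq:
  "log_part p j \<tau> z s = C0_pow \<tau> s * (poly (p j \<tau>) s *
    (2 * jonquiere_log (j - 1) (of_real (2 * ln (rr \<tau>)) * (s - z)) +
     jonquiere_log j (of_real (2 * ln (rr \<tau>)) * (s - z))))"
proof -
  have "2 * (s - z) * of_real (ln (rr \<tau>)) = complex_of_real (2 * ln (rr \<tau>)) * (s - z)" by simp
  then show ?thesis by (simp only: log_part_def Let_def)
qed

lemma halfplane_subset_PP: "\<tau> > 0 \<Longrightarrow> {s. Re s > 0} \<subseteq> - PP \<tau>"
  using norm_qq_less_1[of \<tau>] by (force simp: PP_def)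

text \<open>\<open>Li_0\<close> occurs only for \<open>j = 1\<close> and is the sole source of a
  pole. The radius is kept in the statement so that the expansions of different \<open>j\<close> can
  be summed.\<close>

lemma polylog_term_continuation:
  assumes \<tau>: "\<tau> > 0" and j: "j \<ge> 1"
  shows "\<exists>F. cover_extends (- PP \<tau>) 1 {s. Re s > 0} (polylog_term p j \<tau>) F \<and>
    (\<forall>z\<in>PP \<tau>. sheet_expansion (- PP \<tau>) 1 F z (2 * pi / \<bar>2 * ln (rr \<tau>)\<bar>) 1 (log_part p j \<tau> z))"
proof -
  let ?x = "2 * ln (rr \<tau>)"
  let ?c = "complex_of_real ?x" and ?U = "- PP \<tau>" and ?e = "2 * pi / \<bar>2 * ln (rr \<tau>)\<bar>"
  have x: "?x < 0" using rr_bounds(3)[OF \<tau>] by simp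
  then have c: "?c \<noteq> 0" by simp
  note PP = PP_eq[OF \<tau>] and qq = qq_eq[OF \<tau>]
  obtain L where L0: "L 0 = (\<lambda>C. phi ?c (lift_end C))"
    and L_hol: "\<And>m. holomorphic_on_cover ?U 1 (L m)"
    and L_eq: "\<And>m s. Re s > 0 \<Longrightarrow> L m (path_class ?U (linepath 1 s)) = polylog m (exp (?c * s))"
    and L_sing: "\<And>n z. exp (?c * z) = 1 \<Longrightarrow> sheet_expansion ?U 1 (L (Suc n)) z ?e 0
        (\<lambda>s. jonquiere_log (Suc n) (?c * (s - z)))"
    using polylog_continuation[OF x] unfolding PP[symmetric] by blast
  note HU = halfplane_subset_PP[OF \<tau>]
  define A where "A s = C0_pow \<tau> s * poly (p j \<tau>) s" for s
  have A: "A holomorphic_on S" for S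
    unfolding A_def by (intro holomorphic_intros holomorphic_C0_pow \<tau>)
  define F where "F C = 2 * A (lift_end C) * L (j - 1) C + A (lift_end C) * L j C" for C
  have A2: "(\<lambda>s. 2 * A s) holomorphic_on S" for S by (intro holomorphic_intros A)
  have "holomorphic_on_cover ?U 1 F"
    unfolding F_def
    by (intro holomorphic_on_cover_add holomorphic_on_cover_mult L_hol
        holomorphic_on_cover_lift_end[OF A] holomorphic_on_cover_lift_end[OF A2])
  moreover have "F (path_class ?U (linepath 1 s)) = polylog_term p j \<tau> s" if s: "Re s > 0" for s
    unfolding F_def L_eq[OF s] lift_end_halfplane[OF HU s] polylog_term_def A_def qq
    by (simp add: algebra_simps)
  ultimately have "cover_extends ?U 1 {s. Re s > 0} (polylog_term p j \<tau>) F"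
    unfolding cover_extends_def by blast
  moreover have "sheet_expansion ?U 1 F z ?e 1 (log_part p j \<tau> z)" if z: "z \<in> PP \<tau>" for z
  proof -
    have z': "exp (?c * z) = 1" using z PP by blast
    have sub: "ball z ?e - {z} \<subseteq> ?U"
      using exp_ne_1_punctured_ball[OF z' c] unfolding PP norm_of_real by blast
    have "sheet_expansion ?U 1 (\<lambda>C. 2 * A (lift_end C) * L (j - 1) C) z ?e 1
        (\<lambda>s. 2 * A s * jonquiere_log (j - 1) (?c * (s - z)))"
    proof (cases "j = 1")
      \<comment> \<open>Here \<open>L (j - 1)\<close> is the single-valued \<open>phi\<close>: a
        simple pole and no logarithm, in agreement with \<open>jonquiere_log 0 = 0\<close>.\<close>
      case True
      have hol: "(\<lambda>s. 2 * A s * phi_num ?c z s) holomorphic_on ball z ?e"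
        using holomorphic_phi_num[OF c, of z] unfolding norm_of_real
        by (intro holomorphic_intros A)
      have "sheet_expansion ?U 1 (\<lambda>C. 2 * A (lift_end C) * phi ?c (lift_end C)) z ?e 1 (\<lambda>_. 0)"
        by (rule sheet_expansion_lift_end[OF sub hol, where f = "\<lambda>s. 2 * A s * phi ?c s"])
          (simp only: phi_eq_phi_num[OF z'] power_one_right times_divide_eq_right)
      then show ?thesis by (simp add: True L0 jonquiere_log_def)
    next
      case False
      then obtain n where n: "j - 1 = Suc n" using j by (cases "j - 1") auto
      show ?thesis unfolding n
        by (rule sheet_expansion_mono[OF sheet_expansion_mult_lift_end[OF sub A2 L_sing[OF z']]]) simp
    qed
    moreover obtain n where n: "j = Suc n" using j by (cases j) auto
    have "sheet_expansion ?U 1 (\<lambda>C. A (lift_end C) * L j C) z ?e 1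
        (\<lambda>s. A s * jonquiere_log j (?c * (s - z)))"
      unfolding n
      by (rule sheet_expansion_mono[OF sheet_expansion_mult_lift_end[OF sub A L_sing[OF z']]]) simp
    ultimately have "sheet_expansion ?U 1 F z ?e 1 (\<lambda>s. 2 * A s * jonquiere_log (j - 1) (?c * (s - z))
        + A s * jonquiere_log j (?c * (s - z)))"
      unfolding F_def by (rule sheet_expansion_add)
    then show ?thesis unfolding log_part_eq[abs_def] A_def by (simp add: algebra_simps)
  qed
  ultimately show ?thesis by blast
qed

lemma punctured_ball_subset_PP:
  assumes \<tau>: "\<tau> > 0" and z: "z \<in> PP \<tau>"
  shows "ball z (2 * pi / \<bar>2 * ln (rr \<tau>)\<bar>) - {z} \<subseteq> - PP \<tau>"
  using exp_ne_1_punctured_ball[of "of_real (2 * ln (rr \<tau>))" z] z rr_bounds(3)[OF \<tau>]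
  unfolding PP_eq[OF \<tau>] norm_of_real by auto

lemma first_term_continuation:
  assumes \<tau>: "\<tau> > 0"
  shows "cover_extends (- PP \<tau>) 1 {s. Re s > 0} (first_term \<tau>) (\<lambda>C. first_term \<tau> (lift_end C))"
    and "z \<in> PP \<tau> \<Longrightarrow> sheet_expansion (- PP \<tau>) 1 (\<lambda>C. first_term \<tau> (lift_end C)) z
      (2 * pi / \<bar>2 * ln (rr \<tau>)\<bar>) 2 (\<lambda>_. 0)"
proof -
  note HU = halfplane_subset_PP[OF \<tau>]
  have "first_term \<tau> holomorphic_on - PP \<tau>"
    unfolding first_term_def
    by (intro holomorphic_intros holomorphic_C0_pow holomorphic_qq \<tau>) (auto simp: PP_def)
  then show "cover_extends (- PP \<tau>) 1 {s. Re s > 0} (first_term \<tau>) (\<lambda>C. first_term \<tau> (lift_end C))"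
    unfolding cover_extends_def
    using holomorphic_on_cover_lift_end lift_end_halfplane[OF HU] by simp
  assume z: "z \<in> PP \<tau>"
  show "sheet_expansion (- PP \<tau>) 1 (\<lambda>C. first_term \<tau> (lift_end C)) z
      (2 * pi / \<bar>2 * ln (rr \<tau>)\<bar>) 2 (\<lambda>_. 0)"
    by (rule sheet_expansion_lift_end[OF punctured_ball_subset_PP[OF \<tau> z] holomorphic_first_num[OF \<tau>]])
      (rule first_term_eq_first_num[OF \<tau> z])
qed

lemma displayed_sum_continuation:
  assumes \<tau>: "\<tau> > 0"
  shows "\<exists>F. cover_extends (- PP \<tau>) 1 {s. Re s > 0} (displayed_sum p N \<tau>) F \<and>
    (\<forall>z\<in>PP \<tau>. cover_singularity (- PP \<tau>) 1 F z 2 (\<lambda>s. \<Sum>j=1..N. log_part p j \<tau> z s))"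
proof -
  have "\<forall>j\<in>{1..N}. \<exists>F. cover_extends (- PP \<tau>) 1 {s. Re s > 0} (polylog_term p j \<tau>) F \<and>
    (\<forall>z\<in>PP \<tau>. sheet_expansion (- PP \<tau>) 1 F z (2 * pi / \<bar>2 * ln (rr \<tau>)\<bar>) 1 (log_part p j \<tau> z))"
    using polylog_term_continuation[OF \<tau>] by simp
  then obtain G where G: "\<And>j. j \<in> {1..N} \<Longrightarrow>
      cover_extends (- PP \<tau>) 1 {s. Re s > 0} (polylog_term p j \<tau>) (G j)"
    and G_sing: "\<And>j z. j \<in> {1..N} \<Longrightarrow> z \<in> PP \<tau> \<Longrightarrow>
      sheet_expansion (- PP \<tau>) 1 (G j) z (2 * pi / \<bar>2 * ln (rr \<tau>)\<bar>) 1 (log_part p j \<tau> z)"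
    by (subst (asm) bchoice_iff) blast
  let ?F = "\<lambda>C. first_term \<tau> (lift_end C) + (\<Sum>j=1..N. G j C)"
  have "holomorphic_on_cover (- PP \<tau>) 1 ?F"
    using first_term_continuation(1)[OF \<tau>] G
    by (intro holomorphic_on_cover_add holomorphic_on_cover_sum) (auto simp: cover_extends_def)
  moreover have "?F (path_class (- PP \<tau>) (linepath 1 s)) = displayed_sum p N \<tau> s" if "Re s > 0" for s
    using first_term_continuation(1)[OF \<tau>] G that
    unfolding displayed_sum_def cover_extends_def by (intro arg_cong2[where f = "(+)"] sum.cong) auto
  moreover have "cover_singularity (- PP \<tau>) 1 ?F z 2 (\<lambda>s. \<Sum>j=1..N. log_part p j \<tau> z s)"
    if z: "z \<in> PP \<tau>" for z
  proof (rule cover_singularityI[OF _ punctured_ball_subset_PP[OF \<tau> z]])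
    show "2 * pi / \<bar>2 * ln (rr \<tau>)\<bar> > 0" using rr_bounds(3)[OF \<tau>] by (intro divide_pos_pos) auto
    have "sheet_expansion (- PP \<tau>) 1 ?F z (2 * pi / \<bar>2 * ln (rr \<tau>)\<bar>) 2
        (\<lambda>s. 0 + (\<Sum>j=1..N. log_part p j \<tau> z s))"
      by (intro sheet_expansion_add sheet_expansion_sum first_term_continuation(2)[OF \<tau> z]
          sheet_expansion_mono[OF G_sing[OF _ z]]) auto
    then show "sheet_expansion (- PP \<tau>) 1 ?F z (2 * pi / \<bar>2 * ln (rr \<tau>)\<bar>) 2
        (\<lambda>s. \<Sum>j=1..N. log_part p j \<tau> z s)" by simp
  qed
  ultimately show ?thesis unfolding cover_extends_def by blast
qed

lemma polylog_term_cover_singularity: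
  assumes \<tau>: "\<tau> > 0" and j: "j \<ge> 1"
  shows "\<exists>F. cover_extends (- PP \<tau>) 1 {s. Re s > 0} (polylog_term p j \<tau>) F \<and>
    (\<forall>z\<in>PP \<tau>. cover_singularity (- PP \<tau>) 1 F z 1 (log_part p j \<tau> z))"
proof -
  have "2 * pi / \<bar>2 * ln (rr \<tau>)\<bar> > 0" using rr_bounds(3)[OF \<tau>] by (intro divide_pos_pos) auto
  then show ?thesis
    using polylog_term_continuation[OF assms, of p] punctured_ball_subset_PP[OF \<tau>]
      cover_singularityI by blast
qed

theorem theorem11p3:
  fixes a :: "nat \<Rightarrow> real \<Rightarrow> real"
  assumes "expansion_coeffs a"
  shows
    "(\<forall>N\<ge>2. \<exists>p :: nat \<Rightarrow> real \<Rightarrow> complex poly.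
        (\<forall>j\<in>{1..N}. \<forall>k. smooth_on_reals {0<..} (\<lambda>\<tau>. coeff (p j \<tau>) k)) \<and>
        (\<forall>\<tau>>0.
           (\<forall>j\<in>{1..N}. (\<forall>s. poly (p j \<tau>) s = power_coeff a N \<tau> s j) \<and> poly (p j \<tau>) 0 = 0) \<and>
           (\<forall>s. Re s > 0 \<longrightarrow>
              summable (\<lambda>l. norm (of_nat (2 * l + 1) * sl_pow l \<tau> s)) \<and>
              Z_T s \<tau> =
                C0_pow \<tau> s * ((1 + qq \<tau> s) / (1 - qq \<tau> s) ^ 2)
                + C0_pow \<tau> s * (\<Sum>j=1..N. poly (p j \<tau>) s *
                      (2 * polylog (j - 1) (qq \<tau> s) + polylog j (qq \<tau> s)))
                + remainder p N \<tau> s) \<and>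
           remainder p N \<tau> holomorphic_on {s. Re s > 0} \<and>
           (\<forall>K n. compact K \<and> K \<subseteq> {s. Re s > 0} \<longrightarrow>
              uniform_limit K
                (\<lambda>M s. (deriv ^^ n) (\<lambda>s. 1 - C0_pow \<tau> s) s
                       + (\<Sum>l=1..M. (deriv ^^ n) (remainder_term p N \<tau> l) s))
                ((deriv ^^ n) (remainder p N \<tau>)) sequentially) \<and>
           (\<exists>F. cover_extends (- PP \<tau>) 1 {s. Re s > 0} (displayed_sum p N \<tau>) F \<and>
              (\<forall>z\<in>PP \<tau>. cover_singularity (- PP \<tau>) 1 F z 2
                          (\<lambda>s. \<Sum>j=1..N. log_part p j \<tau> z s))) \<and>
           (\<forall>j\<in>{1..N}. \<exists>F.
              cover_extends (- PP \<tau>) 1 {s. Re s > 0} (polylog_term p j \<tau>) F \<and>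
              (\<forall>z\<in>PP \<tau>. cover_singularity (- PP \<tau>) 1 F z 1 (log_part p j \<tau> z))))) \<and>
     (\<forall>\<tau>>0.
        PP \<tau> = {of_real pi * \<i> * of_int k / of_real (ln (rr \<tau>)) | k :: int. True} \<and>
        (\<forall>z\<in>PP \<tau>. is_pole (first_term \<tau>) z \<and> zorder (first_term \<tau>) z = - 2) \<and>
        (\<lambda>s. first_term \<tau> s
              - (of_real (1 / (2 * (ln (rr \<tau>))\<^sup>2)) * (1 / s\<^sup>2)
                 + of_real ((ln (C0 \<tau>) - ln (rr \<tau>)) / (2 * (ln (rr \<tau>))\<^sup>2)) * (1 / s)))
          \<in> O[at 0](\<lambda>_. 1)) \<and>
     \<not> (\<lambda>\<tau>. 1 / (2 * (ln (rr \<tau>))\<^sup>2)) constant_on {0<..} \<and>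
     \<not> (\<lambda>\<tau>. (ln (C0 \<tau>) - ln (rr \<tau>)) / (2 * (ln (rr \<tau>))\<^sup>2)) constant_on {0<..}"
proof -
  have smooth: "\<And>j. j \<ge> 1 \<Longrightarrow> smooth_on_reals {0<..} (a j)"
    using assms by (simp add: expansion_coeffs_def)
  show ?thesis
    apply (intro conjI allI impI)
    subgoal for N
      apply (rule exI[of _ "power_poly a N"])
      apply (intro conjI allI impI ballI)
      subgoal by (rule smooth_coeff_power_poly[OF smooth])
      subgoal by (rule poly_power_poly)
      subgoal by (rule poly_power_poly_0) simp
      subgoal by (rule summable_Z_T[OF assms])
      subgoal by (rule Z_T_eq[OF assms])
      subgoal by (rule holomorphic_remainder[OF assms])
      subgoal by (rule uniform_limit_deriv_remainder[OF assms]) auto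
      subgoal by (rule displayed_sum_continuation)
      subgoal by (rule polylog_term_cover_singularity) auto
      done
    subgoal by (rule PP_eq_lattice)
    subgoal by (intro ballI conjI first_term_double_pole)
    subgoal by (rule first_term_laurent_0)
    subgoal by (rule polar_coeff_2_not_constant)
    subgoal by (rule polar_coeff_1_not_constant)
    done
qed

end
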